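(* Let $p\ge1$ and $n_1,\dots,n_p\ge1$ be integers, $n=n_1+\cdots+n_p$, and let $A=(A_{[ab]})_{1\le a,b\le p}$ be an $n\times n$ matrix in block form, $A_{[ab]}$ having size $n_a\times n_b$, whose off-diagonal blocks have entries in a field of characteristic $0$ and whose diagonal blocks are $A_{[aa]}=z_aI_{n_a}$, with $z_1,\dots,z_p$ regarded as indeterminates. Let $\mathcal{P}$ be the set of prime cyclic walks on $\{1,\dots,p\}$. Then $$\det A=\underline{z}^{\underline{n}}\prod_{\mathsf{p}\in\mathcal{P}}\det\big(I-\underline{z}^{-\underline{v}(\mathsf{p})}(-A)_{\mathsf{p}}\big)$$ as an equality of Laurent series in $z_1^{-1},\dots,z_p^{-1}$.
   Context: A cyclic walk on $\{1,\dots,p\}$ is a cyclically ordered list $\mathsf{c}=(\!(a_1,\dots,a_k)\!)$ of length $k\ge2$ of elements of $\{1,\dots,p\}$ in which any two successive elements (including $a_k$ and $a_1$) are distinct; i.e. the orbit of such a $k$-tuple under cyclic shifts by $\mathbb{Z}/k\mathbb{Z}$. Its valuation is the order of the stabiliser in $\mathbb{Z}/k\mathbb{Z}$ of $(a_1,\dots,a_k)$; a cyclic walk is prime if its valuation is $1$. $v_a(\mathsf{c})=|\{i:a_i=a\}|$, $\underline{z}^{-\underline{v}(\mathsf{c})}=\prod_az_a^{-v_a(\mathsf{c})}$, and $\underline{z}^{\underline{n}}=\prod_az_a^{n_a}$. For $\mathsf{p}=(\!(a_1,\dots,a_k)\!)$, $(-A)_{\mathsf{p}}$ denotes the $n_{a_1}\times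 n_{a_1}$ matrix $(-A)_{[a_1a_2]}(-A)_{[a_2a_3]}\cdots(-A)_{[a_ka_1]}$, which depends on the choice of starting point, but $\det(I-t(-A)_{\mathsf{p}})$ (with $I=I_{n_{a_1}}$) does not. The infinite product is a product of formal power series in $z_1^{-1},\dots,z_p^{-1}$ with constant term $1$, well defined because there are only finitely many cyclic walks with a given number of visits at each element of $\{1,\dots,p\}$. *)

theory Defs
  imports
    "HOL-Library.Function_Algebras"
    "Jordan_Normal_Form.Determinant"
begin

section \<open>Laurent series in the inverses of finitely many indeterminates\<close>

text \<open>
  The indeterminates \<open>z\<^sub>a\<close> are indexed by the elements \<open>a\<close> of a finite type \<open>'p\<close>. A Laurent series
  in the \<open>z\<^sub>a\<inverse>\<close> assigns a coefficient to each exponent \<open>m :: 'p \<Rightarrow> int\<close>, standing for the monomial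
  \<open>\<Prod>a. z\<^sub>a powi m a\<close> (so exponents refer to \<open>z\<^sub>a\<close>, not to \<open>z\<^sub>a\<inverse>\<close>). Its exponents are bounded above,
  i.e. it is a monomial times a power series in the \<open>z\<^sub>a\<inverse>\<close>.
\<close>

typedef (overloaded) ('p, 'k) laurent =
  "{f :: ('p \<Rightarrow> int) \<Rightarrow> 'k::zero. \<exists>N. \<forall>m. f m \<noteq> 0 \<longrightarrow> m \<le> N}"
  morphisms coeff_laurent Abs_laurent
  by (rule exI[of _ "\<lambda>_. 0"]) auto

setup_lifting type_definition_laurent

lemma laurent_eqI: "(\<And>m. coeff_laurent f m = coeff_laurent g m) \<Longrightarrow> f = g"
  by (simp add: coeff_laurent_inject[symmetric] fun_eq_iff)

lemma finite_int_fun_box: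
  fixes l u :: "'p::finite \<Rightarrow> int"
  shows "finite {l..u}"
proof -
  have "{l..u} \<subseteq> Pi\<^sub>E UNIV (\<lambda>a. {l a..u a})"
    by (auto simp: le_fun_def)
  then show ?thesis
    by (rule finite_subset) (rule finite_PiE, auto)
qed

definition convolve ::
  "(('p \<Rightarrow> int) \<Rightarrow> 'k::semiring_0) \<Rightarrow> (('p \<Rightarrow> int) \<Rightarrow> 'k) \<Rightarrow> ('p \<Rightarrow> int) \<Rightarrow> 'k" where
  "convolve f g m = (\<Sum>i | f i \<noteq> 0 \<and> g (m - i) \<noteq> 0. f i * g (m - i))"

lemma convolve_eq_sum:
  fixes f g :: "('p::finite \<Rightarrow> int) \<Rightarrow> 'k::semiring_0"
  assumes "finite S" "\<And>i. f i \<noteq> 0 \<Longrightarrow> g (m - i) \<noteq> 0 \<Longrightarrow> i \<in> S"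
  shows "convolve f g m = (\<Sum>i\<in>S. f i * g (m - i))"
  unfolding convolve_def
  by (rule sum.mono_neutral_left) (use assms in auto)

lemma convolve_eq_box:
  fixes f g :: "('p::finite \<Rightarrow> int) \<Rightarrow> 'k::semiring_0"
  assumes "\<forall>m. f m \<noteq> 0 \<longrightarrow> m \<le> M" "\<forall>m. g m \<noteq> 0 \<longrightarrow> m \<le> N"
    and "l \<le> m - N" "M \<le> u"
  shows "convolve f g m = (\<Sum>i\<in>{l..u}. f i * g (m - i))"
proof (rule convolve_eq_sum[OF finite_int_fun_box])
  fix i assume "f i \<noteq> 0" "g (m - i) \<noteq> 0"
  then have "i \<le> M" "m - i \<le> N" using assms by auto
  then have "i \<le> M" "m - N \<le> i" by (simp_all add: algebra_simps)
  then show "i \<in> {l..u}"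
    using assms(3,4) by (auto intro: order.trans)
qed

lemma convolve_bounded:
  fixes f g :: "('p \<Rightarrow> int) \<Rightarrow> 'k::semiring_0"
  assumes "\<forall>m. f m \<noteq> 0 \<longrightarrow> m \<le> M" "\<forall>m. g m \<noteq> 0 \<longrightarrow> m \<le> N" "convolve f g m \<noteq> 0"
  shows "m \<le> M + N"
proof -
  from assms(3) obtain i where "f i \<noteq> 0" "g (m - i) \<noteq> 0"
    unfolding convolve_def by (blast elim: sum.not_neutral_contains_not_neutral)
  then have "i \<le> M" "m - i \<le> N" using assms by auto
  then have "i + (m - i) \<le> M + N" by (rule add_mono)
  then show ?thesis by simp
qed

lemma convolve_commute:
  fixes f g :: "('p \<Rightarrow> int) \<Rightarrow> 'k::comm_semiring_0"
  shows "convolve f g m = convolve g f m"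
proof -
  have [simp]: "m - (m - i) = i" for i
    by (simp add: fun_eq_iff)
  show ?thesis
    unfolding convolve_def
    by (rule sum.reindex_bij_witness[of _ "\<lambda>i. m - i" "\<lambda>i. m - i"]) (simp_all add: mult.commute)
qed

lemma convolve_assoc:
  fixes f g h :: "('p::finite \<Rightarrow> int) \<Rightarrow> 'k::semiring_0"
  assumes "\<forall>m. f m \<noteq> 0 \<longrightarrow> m \<le> F" "\<forall>m. g m \<noteq> 0 \<longrightarrow> m \<le> G" "\<forall>m. h m \<noteq> 0 \<longrightarrow> m \<le> H"
  shows "convolve (convolve f g) h m = convolve f (convolve g h) m"
proof -
  define u where "u = F + G"
  define l where "l = m - H - G"
  have fg: "convolve f g i = (\<Sum>j\<in>{l..F}. f j * g (i - j))" if "m - H \<le> i" for i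
    by (rule convolve_eq_box[OF assms(1,2)])
       (use that in \<open>simp_all add: l_def algebra_simps\<close>)
  have gh: "convolve g h (m - j) = (\<Sum>i\<in>{m - H..u}. g (i - j) * h (m - i))" if "j \<le> F" for j
  proof -
    have "convolve g h (m - j) = (\<Sum>k\<in>(\<lambda>i. i - j) ` {m - H..u}. g k * h (m - j - k))"
    proof (rule convolve_eq_sum)
      fix k assume "g k \<noteq> 0" "h (m - j - k) \<noteq> 0"
      then have "k \<le> G" "m - j - k \<le> H" using assms by auto
      then have "k + j \<in> {m - H..u}"
        using add_mono[of k G j F] that by (simp add: u_def algebra_simps)
      then show "k \<in> (\<lambda>i. i - j) ` {m - H..u}"
        by (rule rev_image_eqI) (simp add: fun_eq_iff)
    qed (simp add: finite_int_fun_box)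
    also have "\<dots> = (\<Sum>i\<in>{m - H..u}. g (i - j) * h (m - i))"
      by (subst sum.reindex) (auto simp: inj_on_def)
    finally show ?thesis .
  qed
  have "convolve (convolve f g) h m = (\<Sum>i\<in>{m - H..u}. convolve f g i * h (m - i))"
    by (rule convolve_eq_box[where M = u])
       (use convolve_bounded[OF assms(1,2)] assms(3) in \<open>auto simp: u_def\<close>)
  also have "\<dots> = (\<Sum>i\<in>{m - H..u}. \<Sum>j\<in>{l..F}. f j * g (i - j) * h (m - i))"
    by (rule sum.cong) (auto simp: fg sum_distrib_right)
  also have "\<dots> = (\<Sum>j\<in>{l..F}. \<Sum>i\<in>{m - H..u}. f j * g (i - j) * h (m - i))"
    by (rule sum.swap)
  also have "\<dots> = (\<Sum>j\<in>{l..F}. f j * convolve g h (m - j))"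
    by (rule sum.cong) (auto simp: gh sum_distrib_left mult.assoc)
  also have "\<dots> = convolve f (convolve g h) m"
    by (rule convolve_eq_box[symmetric, where M = F and N = "G + H"])
       (use convolve_bounded[OF assms(2,3)] assms(1) in
         \<open>simp_all add: l_def diff_diff_eq add.commute[of H G] del: minus_apply\<close>)
  finally show ?thesis .
qed

instantiation laurent :: (type, ab_group_add) ab_group_add
begin

lift_definition zero_laurent :: "('p, 'k::ab_group_add) laurent" is "\<lambda>_. 0" by auto

lift_definition plus_laurent ::
  "('p, 'k::ab_group_add) laurent \<Rightarrow> ('p, 'k) laurent \<Rightarrow> ('p, 'k) laurent"
  is "\<lambda>f g m. f m + g m"
proof -
  fix f g :: "('p \<Rightarrow> int) \<Rightarrow> 'k"
  assume "\<exists>N. \<forall>m. f m \<noteq> 0 \<longrightarrow> m \<le> N" "\<exists>N. \<forall>m. g m \<noteq> 0 \<longrightarrow> m \<le> N"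
  then obtain M N where "\<forall>m. f m \<noteq> 0 \<longrightarrow> m \<le> M" "\<forall>m. g m \<noteq> 0 \<longrightarrow> m \<le> N" by blast
  then show "\<exists>N. \<forall>m. f m + g m \<noteq> 0 \<longrightarrow> m \<le> N"
    by (intro exI[of _ "sup M N"]) (force intro: le_supI1 le_supI2)
qed

lift_definition uminus_laurent :: "('p, 'k::ab_group_add) laurent \<Rightarrow> ('p, 'k) laurent"
  is "\<lambda>f m. - f m" by auto

definition minus_laurent ::
  "('p, 'k::ab_group_add) laurent \<Rightarrow> ('p, 'k) laurent \<Rightarrow> ('p, 'k) laurent" where
  "minus_laurent f g = f + - g"

instance
proof
  fix f g h :: "('p, 'k::ab_group_add) laurent"
  show "f + g + h = f + (g + h)" by transfer (simp add: add.assoc)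
  show "f + g = g + f" by transfer (simp add: add.commute)
  show "0 + f = f" by transfer simp
  show "- f + f = 0" by transfer simp
  show "f - g = f + - g" by (rule minus_laurent_def)
qed

end

lemma convolve_delta:
  fixes f :: "('p \<Rightarrow> int) \<Rightarrow> 'k::semiring_1"
  shows "convolve (\<lambda>m. if m = v then c else 0) f m = c * f (m - v)"
proof (cases "c \<noteq> 0 \<and> f (m - v) \<noteq> 0")
  case True
  then have "{i. (if i = v then c else 0) \<noteq> 0 \<and> f (m - i) \<noteq> 0} = {v}" by auto
  then show ?thesis by (simp add: convolve_def)
next
  case False
  then have "{i. (if i = v then c else 0) \<noteq> 0 \<and> f (m - i) \<noteq> 0} = {}" by auto
  with False show ?thesis by (auto simp: convolve_def)
qed

instantiation laurent :: (finite, comm_ring_1) comm_ring_1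
begin

lift_definition one_laurent :: "('p::finite, 'k::comm_ring_1) laurent"
  is "\<lambda>m. if m = 0 then 1 else 0" by auto

lift_definition times_laurent ::
  "('p::finite, 'k::comm_ring_1) laurent \<Rightarrow> ('p, 'k) laurent \<Rightarrow> ('p, 'k) laurent"
  is convolve
  using convolve_bounded by blast

instance
proof
  fix f g h :: "('p::finite, 'k::comm_ring_1) laurent"
  show "f * g * h = f * (g * h)"
    by transfer (auto simp: fun_eq_iff intro: convolve_assoc)
  show "f * g = g * f"
    by transfer (simp add: fun_eq_iff convolve_commute)
  show "1 * f = f"
    by transfer (rule ext, simp add: convolve_delta)
  show "(f + g) * h = f * h + g * h"
  proof (transfer, rule ext)
    fix f g h :: "('p \<Rightarrow> int) \<Rightarrow> 'k" and m
    assume "\<exists>N. \<forall>m. f m \<noteq> 0 \<longrightarrow> m \<le> N" "\<exists>N. \<forall>m. g m \<noteq> 0 \<longrightarrow> m \<le> N"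
      "\<exists>N. \<forall>m. h m \<noteq> 0 \<longrightarrow> m \<le> N"
    then obtain F G H where F: "\<forall>m. f m \<noteq> 0 \<longrightarrow> m \<le> F" and G: "\<forall>m. g m \<noteq> 0 \<longrightarrow> m \<le> G"
      and H: "\<forall>m. h m \<noteq> 0 \<longrightarrow> m \<le> H" by blast
    have FG: "\<forall>m. f m + g m \<noteq> 0 \<longrightarrow> m \<le> sup F G"
      using F G by (force intro: le_supI1 le_supI2)
    show "convolve (\<lambda>m. f m + g m) h m = convolve f h m + convolve g h m"
      by (simp add: convolve_eq_box[OF FG H order.refl order.refl]
          convolve_eq_box[OF F H order.refl sup_ge1[of F G]]
          convolve_eq_box[OF G H order.refl sup_ge2[of G F]]
          distrib_right sum.distrib)
  qed
  show "(0::('p, 'k) laurent) \<noteq> 1"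
    by transfer (metis zero_neq_one)
qed

end

lift_definition monom_laurent :: "('p \<Rightarrow> int) \<Rightarrow> 'k::zero \<Rightarrow> ('p, 'k) laurent"
  is "\<lambda>v c m. if m = v then c else 0" by auto

abbreviation const_laurent :: "'k::zero \<Rightarrow> ('p, 'k) laurent" where
  "const_laurent c \<equiv> monom_laurent 0 c"

abbreviation zpow :: "('p \<Rightarrow> int) \<Rightarrow> ('p, 'k::zero_neq_one) laurent" where
  "zpow v \<equiv> monom_laurent v 1"

abbreviation zvar :: "'p \<Rightarrow> ('p, 'k::zero_neq_one) laurent" where
  "zvar a \<equiv> zpow (\<lambda>b. if b = a then 1 else 0)"

lemma monom_laurent_mult:
  fixes c d :: "'k::comm_ring_1" and v w :: "'p::finite \<Rightarrow> int"
  shows "monom_laurent v c * monom_laurent w d = monom_laurent (v + w) (c * d)"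
proof (transfer, rule ext)
  fix v w m :: "'p \<Rightarrow> int" and c d :: 'k
  have "m - v = w \<longleftrightarrow> m = v + w" by (auto simp: fun_eq_iff algebra_simps)
  then show "convolve (\<lambda>m. if m = v then c else 0) (\<lambda>m. if m = w then d else 0) m
      = (if m = v + w then c * d else 0)"
    by (simp add: convolve_delta)
qed

lemma monom_laurent_0_1: "monom_laurent 0 1 = 1"
  by transfer (rule refl)

lemma monom_laurent_power: "zpow v ^ k = zpow (\<lambda>a. int k * v a)"
proof (induction k)
  case 0
  show ?case by (simp flip: monom_laurent_0_1 add: zero_fun_def)
next
  case (Suc k)
  have "v + (\<lambda>a. int k * v a) = (\<lambda>a. int (Suc k) * v a)"
    by (simp add: fun_eq_iff algebra_simps)
  with Suc show ?case by (simp add: monom_laurent_mult)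
qed

lemma zpow_eq_prod:
  "(zpow (\<lambda>a. int (n a)) :: ('p::finite, 'k::comm_ring_1) laurent) = (\<Prod>a\<in>UNIV. zvar a ^ n a)"
proof -
  have "(\<Prod>a\<in>S. zvar a ^ n a)
      = (zpow (\<lambda>b. if b \<in> S then int (n b) else 0) :: ('p, 'k) laurent)"
    if "finite S" for S
    using that
  proof induction
    case empty
    show ?case by (simp flip: monom_laurent_0_1 add: zero_fun_def)
  next
    case (insert x S)
    have "(\<lambda>b. int (n x) * (if b = x then 1 else 0)) + (\<lambda>b. if b \<in> S then int (n b) else 0)
        = (\<lambda>b. if b \<in> insert x S then int (n b) else 0)"
      using insert.hyps by (auto simp: fun_eq_iff)
    with insert show ?case by (simp add: monom_laurent_power monom_laurent_mult)
  qed
  from this[of UNIV] show ?thesis by simp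
qed


section \<open>Infinite products of formal series\<close>

text \<open>
  Convergence is that of formal series: each coefficient of the finite partial products is
  eventually constant along the directed set of finite subsets of the index set, irrespective of
  any order on the index set.
\<close>

definition has_formal_prod ::
  "('i \<Rightarrow> ('p::finite, 'k::comm_ring_1) laurent) \<Rightarrow> 'i set \<Rightarrow> ('p, 'k) laurent \<Rightarrow> bool" where
  "has_formal_prod f I L \<longleftrightarrow>
     (\<forall>m. eventually (\<lambda>F. coeff_laurent (\<Prod>i\<in>F. f i) m = coeff_laurent L m)
            (finite_subsets_at_top I))"

definition formally_multipliable ::
  "('i \<Rightarrow> ('p::finite, 'k::comm_ring_1) laurent) \<Rightarrow> 'i set \<Rightarrow> bool" where
  "formally_multipliable f I \<longleftrightarrow> (\<exists>L. has_formal_prod f I L)"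

definition formal_prod ::
  "('i \<Rightarrow> ('p::finite, 'k::comm_ring_1) laurent) \<Rightarrow> 'i set \<Rightarrow> ('p, 'k) laurent" where
  "formal_prod f I = (THE L. has_formal_prod f I L)"

lemma has_formal_prod_unique:
  assumes "has_formal_prod f I L" "has_formal_prod f I M"
  shows "L = M"
proof (rule laurent_eqI)
  fix m
  have "eventually (\<lambda>F. coeff_laurent (\<Prod>i\<in>F. f i) m = coeff_laurent L m) (finite_subsets_at_top I)"
    "eventually (\<lambda>F. coeff_laurent (\<Prod>i\<in>F. f i) m = coeff_laurent M m) (finite_subsets_at_top I)"
    using assms by (simp_all add: has_formal_prod_def)
  then have "eventually (\<lambda>F. coeff_laurent L m = coeff_laurent M m) (finite_subsets_at_top I)"
    by eventually_elim simp
  then show "coeff_laurent L m = coeff_laurent M m"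
    by (simp add: eventually_const_iff)
qed

lemma formal_prod_eqI: "has_formal_prod f I L \<Longrightarrow> formal_prod f I = L"
  unfolding formal_prod_def by (rule the_equality) (auto intro: has_formal_prod_unique)


section \<open>Cyclic walks\<close>

text \<open>
  The letters \<open>1, \<dots>, p\<close> are the elements of \<open>'p\<close>; the pairs of successive elements of a cyclically
  ordered list \<open>as\<close>, including the pair (last, first), are the members of \<open>zip as (rotate1 as)\<close>.
\<close>

definition closed_walk :: "'p list \<Rightarrow> bool" where
  "closed_walk as \<longleftrightarrow> 2 \<le> length as \<and> (\<forall>(a, b) \<in> set (zip as (rotate1 as)). a \<noteq> b)"

definition cyclic_class :: "'p list \<Rightarrow> 'p list set" where
  "cyclic_class as = {rotate i as | i. i < length as}"

definition cyclic_walks :: "'p list set set" where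
  "cyclic_walks = {cyclic_class as | as. closed_walk as}"

definition stabiliser :: "'p list \<Rightarrow> nat set" where
  "stabiliser as = {i. i < length as \<and> rotate i as = as}"

text \<open>
  Valuation and visits do not depend on the starting point, so \<open>the_elem\<close> below is applied to a
  singleton, see \<open>valuation_cyclic_class\<close> and \<open>visits_cyclic_class\<close>.
\<close>

definition valuation :: "'p list set \<Rightarrow> nat" where
  "valuation c = the_elem ((\<lambda>as. card (stabiliser as)) ` c)"

definition visits :: "'p list set \<Rightarrow> 'p \<Rightarrow> nat" where
  "visits c a = the_elem ((\<lambda>as. count_list as a) ` c)"

definition prime_cyclic_walks :: "'p list set set" where
  "prime_cyclic_walks = {c \<in> cyclic_walks. valuation c = 1}"

lemma rotate_inverse:
  assumes "as \<noteq> []" shows "\<exists>j. rotate j (rotate i as) = as"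
proof
  have "length as dvd i * length as" by simp
  moreover have "i * (length as - 1) + i = i * length as"
    using assms by (cases "length as") (simp_all add: algebra_simps)
  ultimately show "rotate (i * (length as - 1)) (rotate i as) = as"
    by (simp add: rotate_rotate rotate_id)
qed

lemma stabiliser_rotate: "stabiliser (rotate i as) = stabiliser as"
proof (cases "as = []")
  case False
  have "rotate j (rotate i as) = rotate i as \<longleftrightarrow> rotate j as = as" for j
  proof
    assume *: "rotate j (rotate i as) = rotate i as"
    obtain k where k: "rotate k (rotate i as) = as" using rotate_inverse[OF False] by blast
    have "rotate j as = rotate k (rotate j (rotate i as))"
      by (metis add.commute k rotate_rotate)
    then show "rotate j as = as" using * k by simp
  qed (metis add.commute rotate_rotate)
  then show ?thesis by (simp add: stabiliser_def)
qed (simp add: stabiliser_def)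

lemma valuation_cyclic_class:
  assumes "as \<noteq> []" shows "valuation (cyclic_class as) = card (stabiliser as)"
proof -
  have "(\<lambda>as. card (stabiliser as)) ` cyclic_class as = {card (stabiliser as)}"
    using assms by (auto simp: cyclic_class_def stabiliser_rotate image_iff intro!: exI[of _ 0])
  then show ?thesis by (simp add: valuation_def)
qed

lemma visits_cyclic_class:
  assumes "as \<noteq> []" shows "visits (cyclic_class as) a = count_list as a"
proof -
  have *: "count_list (rotate1 bs) a = count_list bs a" for bs
    by (cases bs) simp_all
  have "count_list (rotate i as) a = count_list as a" for i
    by (induction i) (simp_all add: *)
  then have "(\<lambda>as. count_list as a) ` cyclic_class as = {count_list as a}"
    using assms by (auto simp: cyclic_class_def image_iff intro!: exI[of _ 0])
  then show ?thesis by (simp add: visits_def)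
qed


section \<open>Block matrices\<close>

text \<open>
  \<open>block n A a b\<close> is the block in position \<open>(a, b)\<close> when rows and columns of \<open>A\<close> (numbered from 0)
  are cut into consecutive intervals of lengths \<open>n a\<close>, in the order of the finite linear order \<open>'p\<close>.
\<close>

definition block :: "('p::linorder \<Rightarrow> nat) \<Rightarrow> 'r mat \<Rightarrow> 'p \<Rightarrow> 'p \<Rightarrow> 'r mat" where
  "block n A a b = mat (n a) (n b) (\<lambda>(i, j). A $$ (sum n {..<a} + i, sum n {..<b} + j))"

text \<open>
  \<open>walk_mat n A [a\<^sub>1, \<dots>, a\<^sub>k]\<close> is the product of the blocks \<open>(a\<^sub>1, a\<^sub>2)\<close>, \<open>(a\<^sub>2, a\<^sub>3)\<close>, \<open>\<dots>\<close>, \<open>(a\<^sub>k, a\<^sub>1)\<close>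
  of \<open>A\<close>, for a given starting point.
\<close>

definition walk_mat :: "('p::linorder \<Rightarrow> nat) \<Rightarrow> 'r::semiring_1 mat \<Rightarrow> 'p list \<Rightarrow> 'r mat" where
  "walk_mat n A as =
     foldr (\<lambda>(a, b) X. block n A a b * X) (zip as (rotate1 as)) (1\<^sub>m (n (hd as)))"

end

theory Submission
  imports Defs
begin

text \<open>
  Write \<open>A = D (1 - M)\<close> with \<open>D\<close> the block diagonal part of \<open>A\<close>. Then \<open>det D\<close> is the monomial in
  front of the product, the diagonal blocks of \<open>M\<close> vanish, its other blocks are \<open>- A\<^sub>a\<^sub>b / z\<^sub>a\<close>, and
  the product \<open>M\<^sub>c\<close> of the blocks of \<open>M\<close> along a walk \<open>c\<close> is the product of the blocks of \<open>- A\<close>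
  times the inverse of the monomial of visits. So the claim becomes
  \<open>det (1 - M) = \<Prod>c. det (1 - M\<^sub>c)\<close>, the product being over the prime cyclic walks (an identity of
  Amitsur).

  Heuristically, \<open>- log det (1 - M) = (\<Sum>k>0. tr (M ^ k) / k)\<close>, and \<open>tr (M ^ k)\<close> is the sum of
  \<open>tr M\<^sub>w\<close> over the closed walks \<open>w\<close> of length \<open>k\<close>. Every such \<open>w\<close> is a power \<open>u ^ j\<close> of a unique
  primitive word \<open>u\<close>, and \<open>tr M\<^sub>w = tr (M\<^sub>u ^ j)\<close> depends only on \<open>j\<close> and the cyclic class of \<open>u\<close>,
  which contains as many words as \<open>u\<close> has letters. Grouping by these classes gives
  \<open>\<Sum>c. \<Sum>j>0. tr (M\<^sub>c ^ j) / j\<close>, which is \<open>- \<Sum>c. log det (1 - M\<^sub>c)\<close>.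

  Instead of logarithms the proof uses the Euler derivation \<open>E\<close> of the ring of Laurent series,
  which multiplies each monomial by its total degree. The entries of \<open>M\<^sub>w\<close> are homogeneous of
  degree \<open>- length w\<close>, so Jacobi's formula for the derivative of a determinant gives
  \<open>E (det (1 - M\<^sub>w)) = det (1 - M\<^sub>w) * length w * (\<Sum>j>0. tr (M\<^sub>w ^ j))\<close>, in a truncated form with an
  error of high order in the \<open>z\<^sub>a\<inverse>\<close> (\<open>log_derivative_det\<close>). The same holds for \<open>M\<close> itself, with
  degree \<open>- 1\<close> and 1 in place of \<open>length w\<close>. By the counting above (\<open>sum_closed_walks\<close>,
  \<open>sum_trace_pow_mat\<close>) the determinant of \<open>1 - M\<close> and a partial product that includes all prime
  walks of length at most \<open>K\<close> have the same logarithmic derivative up to order \<open>K + 1\<close>. In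
  characteristic 0, a series with constant term 1 is determined by its logarithmic derivative,
  order by order (\<open>log_derivative_unique\<close>). Hence the two agree up to order \<open>K + 1\<close>.
\<close>

section \<open>Powers and primitive roots of words\<close>

abbreviation word_power :: "'a list \<Rightarrow> nat \<Rightarrow> 'a list" where
  "word_power w j \<equiv> concat (replicate j w)"

lemma length_word_power: "length (word_power w j) = j * length w"
  by (induction j) auto

lemma rotate1_word_power: "rotate1 (word_power w j) = word_power (rotate1 w) j"
proof (cases w)
  case (Cons a v)
  have *: "word_power (a # v) i @ [a] = a # word_power (v @ [a]) i" for i
    by (induction i) auto
  show ?thesis
    using * by (cases j) (simp_all add: Cons)
qed simp

lemma rotate_word_power: "rotate i (word_power w j) = word_power (rotate i w) j"
  by (induction i) (simp_all add: rotate1_word_power)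

lemma zip_word_power:
  "length v = length w \<Longrightarrow> zip (word_power v j) (word_power w j) = word_power (zip v w) j"
  by (induction j) auto

lemma word_power_inject:
  assumes "length v = length w" "0 < j"
  shows "word_power v j = word_power w j \<longleftrightarrow> v = w"
  using assms by (cases j) auto

definition primitive :: "'a list \<Rightarrow> bool" where
  "primitive w \<longleftrightarrow> w \<noteq> [] \<and> stabiliser w = {0}"

lemma primitiveD: "primitive w \<Longrightarrow> i < length w \<Longrightarrow> rotate i w = w \<Longrightarrow> i = 0"
  by (auto simp: primitive_def stabiliser_def)

lemma primitive_iff_card:
  assumes "w \<noteq> []" shows "primitive w \<longleftrightarrow> card (stabiliser w) = 1"
proof -
  have "0 \<in> stabiliser w" using assms by (simp add: stabiliser_def)
  then show ?thesis using assms by (auto simp: primitive_def card_1_singleton_iff)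
qed

lemma primitive_rotate: "primitive (rotate i w) \<longleftrightarrow> primitive w"
  by (simp add: primitive_def stabiliser_rotate)

text \<open>
  If a proper rotation fixes \<open>w\<close>, the two parts into which it cuts \<open>w\<close> commute, so they are powers
  of a common shorter word, and so is \<open>w\<close>.
\<close>

lemma primitive_root_exists:
  assumes "w \<noteq> []" shows "\<exists>u j. primitive u \<and> 0 < j \<and> w = word_power u j"
  using assms
proof (induction "length w" arbitrary: w rule: less_induct)
  case less
  show ?case
  proof (cases "primitive w")
    case True
    then show ?thesis by (intro exI[of _ w] exI[of _ 1]) simp
  next
    case False
    have "0 \<in> stabiliser w" using less.prems by (simp add: stabiliser_def)
    with False less.prems obtain i where i: "0 < i" "i < length w" "rotate i w = w"
      by (auto simp: primitive_def stabiliser_def)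
    have "drop i w @ take i w = take i w @ drop i w"
      using i by (simp add: rotate_drop_take)
    then obtain m k v where v: "word_power v m = drop i w" "word_power v k = take i w"
      using comm_append_are_replicate by blast
    have "m \<noteq> 0"
      using v(1) i(2) by (cases m) auto
    moreover have "k \<noteq> 0" "v \<noteq> []"
      using v(2) i by (cases k; force)+
    ultimately have nontrivial: "m \<noteq> 0" "k \<noteq> 0" "v \<noteq> []" by blast+
    have w: "w = word_power v (k + m)"
      using v by (simp add: replicate_add)
    have "length v < length w"
    proof -
      have "1 * length v < (k + m) * length v"
        using nontrivial by (intro mult_strict_right_mono) auto
      then show ?thesis unfolding w by (simp only: length_word_power mult_1)
    qed
    from less.hyps[OF this nontrivial(3)] obtain u j
      where u: "primitive u" "0 < j" "v = word_power u j" by blast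
    have "word_power (word_power u j) i = word_power u (i * j)" for i
      by (induction i) (simp_all add: replicate_add)
    then show ?thesis
      using u w nontrivial(1) by (intro exI[of _ u] exI[of _ "(k + m) * j"]) simp
  qed
qed

text \<open>
  Rotation by \<open>length u\<close> fixes \<open>u ^ i = v ^ j\<close>, hence fixes \<open>v\<close>, because rotation commutes with
  powers. For primitive \<open>v\<close> this excludes \<open>length u < length v\<close>; by symmetry the lengths agree.
\<close>

lemma primitive_root_unique:
  assumes "primitive u" "primitive v" "0 < i" "0 < j" "word_power u i = word_power v j"
  shows "u = v \<and> i = j"
proof -
  have not_less: "\<not> length u < length v"
    if "primitive u" "primitive v" "0 < j" "word_power u i = word_power v j"
    for u v :: "'a list" and i j :: nat
  proof
    assume less: "length u < length v"
    have "word_power (rotate (length u) v) j = word_power v j"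
      using that(4) rotate_word_power[of "length u" i u] rotate_word_power[of "length u" j v]
      by simp
    then have "rotate (length u) v = v"
      using word_power_inject[of "rotate (length u) v" v j] that(3) by simp
    then have "length u = 0" using primitiveD[OF that(2)] less by blast
    then show False using that(1) by (simp add: primitive_def)
  qed
  have len: "length u = length v"
    using not_less[of u v j i] not_less[of v u i j] assms by simp
  have "i * length u = j * length v"
    using assms(5) by (metis length_word_power)
  moreover have "length v \<noteq> 0" using assms(2) by (simp add: primitive_def)
  ultimately have "i = j" unfolding len by (metis mult_cancel2)
  then show ?thesis using word_power_inject[OF len, of j] assms by simp
qed

section \<open>Closed walks grouped by primitive root\<close>

lemma closed_walk_rotate: "closed_walk (rotate i w) \<longleftrightarrow> closed_walk w"
proof -
  have "zip (rotate i w) (rotate1 (rotate i w)) = rotate i (zip w (rotate1 w))"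
  proof (cases "w = []")
    case False
    show ?thesis
      by (rule nth_equalityI)
         (use False in \<open>auto simp: nth_rotate nth_rotate1 mod_simps\<close>)
  qed simp
  then show ?thesis by (simp add: closed_walk_def)
qed

text \<open>
  The cyclically successive pairs in a power of \<open>u\<close> are those in \<open>u\<close>. A one-letter \<open>u\<close> is ruled
  out by its pair of equal letters, which reappears in every power.
\<close>

lemma closed_walk_word_power:
  assumes "0 < j" shows "closed_walk (word_power u j) \<longleftrightarrow> closed_walk u"
proof -
  have pairs: "set (zip (word_power u j) (rotate1 (word_power u j))) = set (zip u (rotate1 u))"
    using assms by (simp add: rotate1_word_power zip_word_power)
  have "length u \<le> length (word_power u j)"
    using assms by (simp add: length_word_power)
  moreover have "\<not> closed_walk (word_power u j)" if "\<not> 2 \<le> length u"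
  proof -
    have "length u = 0 \<or> length u = 1" using that by linarith
    then show ?thesis
    proof
      assume "length u = 1"
      then obtain a where "u = [a]" by (auto simp: length_Suc_conv)
      then show ?thesis using pairs by (auto simp: closed_walk_def)
    qed (simp add: closed_walk_def)
  qed
  ultimately show ?thesis
    unfolding closed_walk_def pairs by (meson order.trans)
qed

lemma cyclic_class_subset: "u \<in> cyclic_class v \<Longrightarrow> cyclic_class u \<subseteq> cyclic_class v"
proof
  fix w assume "u \<in> cyclic_class v" "w \<in> cyclic_class u"
  then obtain i j where "u = rotate i v" "w = rotate j u" "i < length v"
    by (auto simp: cyclic_class_def)
  then have "w = rotate ((j + i) mod length v) v" "(j + i) mod length v < length v"
    by (simp add: rotate_rotate rotate_conv_mod[of "j + i"], intro mod_less_divisor, linarith)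
  then show "w \<in> cyclic_class v" unfolding cyclic_class_def by blast
qed

lemma cyclic_class_eq: 
  assumes "u \<in> cyclic_class v" shows "cyclic_class u = cyclic_class v"
proof -
  obtain i where i: "u = rotate i v" "i < length v" using assms by (auto simp: cyclic_class_def)
  then have "v \<noteq> []" by auto
  from rotate_inverse[OF this] obtain j where "rotate j u = v" using i by blast
  then have "v = rotate (j mod length u) u" "j mod length u < length u"
    using i \<open>v \<noteq> []\<close> by (simp_all add: rotate_conv_mod[of j "rotate i v"])
  then have "v \<in> cyclic_class u" unfolding cyclic_class_def by blast
  then show ?thesis using assms cyclic_class_subset by blast
qed

lemma mem_cyclic_class: "w \<noteq> [] \<Longrightarrow> w \<in> cyclic_class w"
  unfolding cyclic_class_def by (rule CollectI, rule exI[of _ 0]) simp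

lemma closed_walk_nonempty: "closed_walk w \<Longrightarrow> w \<noteq> []"
  by (auto simp: closed_walk_def)

lemma mem_prime_cyclic_walks_iff:
  "c \<in> prime_cyclic_walks \<longleftrightarrow> (\<exists>u. closed_walk u \<and> primitive u \<and> c = cyclic_class u)"
  unfolding prime_cyclic_walks_def cyclic_walks_def
  using closed_walk_nonempty valuation_cyclic_class primitive_iff_card by fastforce

lemma prime_cyclic_walk_member:
  assumes "c \<in> prime_cyclic_walks" "w \<in> c"
  shows "closed_walk w" "primitive w" "c = cyclic_class w"
proof -
  obtain u where u: "closed_walk u" "primitive u" "c = cyclic_class u"
    using assms by (auto simp: mem_prime_cyclic_walks_iff)
  then obtain i where i: "w = rotate i u" using assms by (auto simp: cyclic_class_def)
  show "closed_walk w" "primitive w"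
    using u unfolding i by (simp_all add: closed_walk_rotate primitive_rotate)
  show "c = cyclic_class w"
    using u assms cyclic_class_eq by blast
qed

lemma inj_on_rotate_primitive:
  assumes "primitive w" shows "inj_on (\<lambda>i. rotate i w) {..<length w}"
proof -
  have "i = j" if "i \<le> j" "j < length w" "rotate i w = rotate j w" for i j
  proof -
    have "w \<noteq> []" using assms by (simp add: primitive_def)
    then obtain k where k: "rotate k (rotate i w) = w" using rotate_inverse by blast
    have "rotate (j - i) w = rotate (j - i) (rotate k (rotate i w))"
      by (simp add: k)
    also have "\<dots> = rotate k (rotate ((j - i) + i) w)"
      by (simp add: rotate_rotate add_ac)
    also have "\<dots> = w" using that k by simp
    finally show ?thesis
      using primitiveD[OF assms, of "j - i"] that by linarith
  qed
  then show ?thesis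
    by (intro inj_onI) (metis lessThan_iff nat_le_linear)
qed

lemma finite_words_length_le: "finite {w :: 'p::finite list. length w \<le> K \<and> P w}"
  by (rule finite_subset[OF _ finite_lists_length_le[of UNIV K]]) auto

text \<open>
  The rotations of a primitive word are pairwise distinct, so a prime cyclic walk consists of as
  many words as it has letters.
\<close>

lemma sum_prime_cyclic_walk:
  fixes f :: "'p list \<Rightarrow> 'b::comm_semiring_1"
  assumes "c \<in> prime_cyclic_walks" "w \<in> c" and f: "\<And>i. f (rotate i w) = f w"
  shows "(\<Sum>u\<in>c. f u) = of_nat (length w) * f w"
proof -
  note w = prime_cyclic_walk_member[OF assms(1,2)]
  have "c = (\<lambda>i. rotate i w) ` {..<length w}"
    unfolding w(3) by (auto simp: cyclic_class_def)
  then have "(\<Sum>u\<in>c. f u) = (\<Sum>i<length w. f (rotate i w))"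
    using inj_on_rotate_primitive[OF w(2)] by (simp add: sum.reindex)
  then show ?thesis by (simp add: f)
qed

lemma finite_prime_cyclic_walks_length_le:
  fixes start :: "'p::finite list set \<Rightarrow> 'p list"
  assumes "\<And>c. c \<in> prime_cyclic_walks \<Longrightarrow> start c \<in> c"
  shows "finite {c \<in> prime_cyclic_walks. length (start c) \<le> K}"
proof (rule finite_subset)
  show "{c \<in> prime_cyclic_walks. length (start c) \<le> K} \<subseteq> cyclic_class ` {w. length w \<le> K \<and> True}"
    using assms prime_cyclic_walk_member(3) by fastforce
qed (rule finite_imageI, rule finite_words_length_le)

text \<open>
  Each closed walk is \<open>u ^ j\<close> for exactly one primitive closed walk \<open>u\<close> and one \<open>j > 0\<close>; the \<open>u\<close>
  of length at most \<open>K\<close> are partitioned by the prime cyclic walks, and all members of a class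
  contribute equally.
\<close>

lemma sum_closed_walks:
  fixes f :: "'p::finite list \<Rightarrow> 'b::comm_semiring_1"
    and start :: "'p list set \<Rightarrow> 'p list"
  assumes start: "\<And>c. c \<in> prime_cyclic_walks \<Longrightarrow> start c \<in> c"
    and f: "\<And>i w. w \<noteq> [] \<Longrightarrow> f (rotate i w) = f w"
  shows "(\<Sum>w | length w \<le> K \<and> closed_walk w. f w) =
    (\<Sum>c | c \<in> prime_cyclic_walks \<and> length (start c) \<le> K.
       of_nat (length (start c)) * (\<Sum>j = 1..K div length (start c). f (word_power (start c) j)))"
proof -
  define U where "U = {u :: 'p list. length u \<le> K \<and> (closed_walk u \<and> primitive u)}"
  define C where "C = {c :: 'p list set. c \<in> prime_cyclic_walks \<and> length (start c) \<le> K}"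
  define g where "g u = (\<Sum>j = 1..K div length u. f (word_power u j))" for u
  let ?S = "SIGMA u:U. {1..K div length u}"
  have nonempty: "u \<noteq> []" if "u \<in> U" for u using that by (simp add: U_def primitive_def)
  have le: "j * length u \<le> K \<longleftrightarrow> j \<le> K div length u" if "u \<in> U" for u j
    using nonempty[OF that] by (simp add: less_eq_div_iff_mult_less_eq)
  have bij: "bij_betw (\<lambda>(u, j). word_power u j) ?S {w. length w \<le> K \<and> closed_walk w}"
  proof (rule bij_betwI')
    fix x y assume "x \<in> ?S" "y \<in> ?S"
    then obtain u i v j where "x = (u, i)" "y = (v, j)" "primitive u" "primitive v" "0 < i" "0 < j"
      by (auto simp: U_def)
    then show "((\<lambda>(u, j). word_power u j) x = (\<lambda>(u, j). word_power u j) y) \<longleftrightarrow> x = y"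
      using primitive_root_unique[of u v i j] by auto
  next
    fix x assume "x \<in> ?S"
    then show "(\<lambda>(u, j). word_power u j) x \<in> {w. length w \<le> K \<and> closed_walk w}"
      by (auto simp: length_word_power le closed_walk_word_power) (auto simp: U_def)
  next
    fix w :: "'p list" assume "w \<in> {w. length w \<le> K \<and> closed_walk w}"
    then have w: "length w \<le> K" "closed_walk w" by auto
    obtain u j where u: "primitive u" "0 < j" "w = word_power u j"
      using primitive_root_exists[OF closed_walk_nonempty[OF w(2)]] by blast
    have "j * length u \<le> K" using w u by (simp add: length_word_power)
    moreover have "1 * length u \<le> j * length u" using u(2) by (intro mult_right_mono) auto
    ultimately have "length u \<le> K" by linarith
    then have "u \<in> U"
      using w u by (simp add: U_def closed_walk_word_power)
    moreover have "j \<le> K div length u" using le[OF \<open>u \<in> U\<close>] \<open>j * length u \<le> K\<close> by simp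
    ultimately have "(u, j) \<in> ?S" using u(2) by simp
    then show "\<exists>x\<in>?S. w = (\<lambda>(u, j). word_power u j) x" using u(3) by force
  qed
  have C_length: "length w = length (start c)" "w \<noteq> []" if "c \<in> C" "w \<in> c" for c w
  proof -
    have c: "c \<in> prime_cyclic_walks" using that by (simp add: C_def)
    have "w \<in> cyclic_class (start c)"
      using prime_cyclic_walk_member(3)[OF c start[OF c]] that by simp
    then show "length w = length (start c)" by (auto simp: cyclic_class_def)
    show "w \<noteq> []" using prime_cyclic_walk_member(1)[OF c] that closed_walk_nonempty by blast
  qed
  have U_eq: "U = (\<Union>c\<in>C. c)"
  proof (intro equalityI subsetI)
    fix u assume u: "u \<in> U"
    then have c: "cyclic_class u \<in> prime_cyclic_walks" 
      by (auto simp: U_def mem_prime_cyclic_walks_iff)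
    then have "start (cyclic_class u) \<in> cyclic_class u" by (rule start)
    then have "length (start (cyclic_class u)) = length u" by (auto simp: cyclic_class_def)
    then have "cyclic_class u \<in> C" using c u by (simp add: C_def U_def)
    then show "u \<in> (\<Union>c\<in>C. c)"
      using mem_cyclic_class[OF nonempty[OF u]] by blast
  next
    fix u assume "u \<in> (\<Union>c\<in>C. c)"
    then obtain c where c: "c \<in> C" "u \<in> c" by blast
    then have "c \<in> prime_cyclic_walks" "length u \<le> K" using C_length[OF c] by (simp_all add: C_def)
    then show "u \<in> U" using prime_cyclic_walk_member[of c u] c by (simp add: U_def)
  qed
  have fin_U: "finite U" unfolding U_def by (rule finite_words_length_le)
  have fin_C: "finite C"
    unfolding C_def using finite_prime_cyclic_walks_length_le[OF start] by simp
  have "(\<Sum>w | length w \<le> K \<and> closed_walk w. f w) = (\<Sum>(u, j)\<in>?S. f (word_power u j))"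
    by (subst sum.reindex_bij_betw[OF bij, symmetric]) (simp add: case_prod_beta)
  also have "\<dots> = (\<Sum>u\<in>U. g u)"
    using fin_U by (subst sum.Sigma[symmetric]) (simp_all add: g_def)
  also have "\<dots> = (\<Sum>c\<in>C. \<Sum>u\<in>c. g u)"
    unfolding U_eq
  proof (rule sum.UNION_disjoint[OF fin_C])
    show "\<forall>c\<in>C. finite c"
      using finite_subset[OF _ fin_U] unfolding U_eq by auto
    show "\<forall>c\<in>C. \<forall>d\<in>C. c \<noteq> d \<longrightarrow> c \<inter> d = {}"
      unfolding C_def using prime_cyclic_walk_member(3) by blast
  qed
  also have "\<dots> = (\<Sum>c\<in>C. of_nat (length (start c)) * g (start c))"
  proof (rule sum.cong[OF refl])
    fix c assume "c \<in> C"
    then have c: "c \<in> prime_cyclic_walks" by (simp add: C_def)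
    have "g (rotate i (start c)) = g (start c)" for i
      unfolding g_def using C_length(2)[OF \<open>c \<in> C\<close> start[OF c]]
      by (intro sum.cong) (auto simp flip: rotate_word_power intro!: f)
    then show "(\<Sum>u\<in>c. g u) = of_nat (length (start c)) * g (start c)"
      by (rule sum_prime_cyclic_walk[OF c start[OF c]])
  qed
  finally show ?thesis unfolding C_def g_def .
qed

section \<open>Order of vanishing and the Euler derivation\<close>

definition total_degree :: "('p::finite \<Rightarrow> int) \<Rightarrow> int" where
  "total_degree m = (\<Sum>a\<in>UNIV. m a)"

lemma total_degree_add: "total_degree (m + k) = total_degree m + total_degree k"
  by (simp add: total_degree_def sum.distrib)

lemma coeff_laurent_simps:
  "coeff_laurent 0 m = 0" "coeff_laurent (f + g) m = coeff_laurent f m + coeff_laurent g m"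
  "coeff_laurent (- f) m = - coeff_laurent f m"
  "coeff_laurent (f - g) m = coeff_laurent f m - coeff_laurent g m"
  by (simp_all add: zero_laurent.rep_eq plus_laurent.rep_eq uminus_laurent.rep_eq
      minus_laurent_def del: add_uminus_conv_diff)

lemma coeff_laurent_1: "coeff_laurent 1 m = (if m = 0 then 1 else 0)"
  by transfer (rule refl)

lemma coeff_laurent_of_nat_mult: "coeff_laurent (of_nat k * f) m = of_nat k * coeff_laurent f m"
  by (induction k) (simp_all add: coeff_laurent_simps distrib_right)

lemma coeff_mult_nonzero:
  assumes "coeff_laurent (f * g) m \<noteq> 0"
  obtains i where "coeff_laurent f i \<noteq> 0" "coeff_laurent g (m - i) \<noteq> 0"
  using assms unfolding times_laurent.rep_eq convolve_def
  by (blast elim: sum.not_neutral_contains_not_neutral)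

text \<open>
  The order refers to the variables \<open>z\<^sub>a\<inverse>\<close>, whence the signs: the total degree in the \<open>z\<^sub>a\<close> is at
  most \<open>- d\<close>, or equal to \<open>- d\<close> in the homogeneous case.
\<close>

definition order_ge :: "nat \<Rightarrow> ('p::finite, 'k::zero) laurent \<Rightarrow> bool" where
  "order_ge d f \<longleftrightarrow> (\<forall>m. coeff_laurent f m \<noteq> 0 \<longrightarrow> total_degree m \<le> - int d)"

definition homogeneous :: "nat \<Rightarrow> ('p::finite, 'k::zero) laurent \<Rightarrow> bool" where
  "homogeneous d f \<longleftrightarrow> (\<forall>m. coeff_laurent f m \<noteq> 0 \<longrightarrow> total_degree m = - int d)"

lemma order_ge_0: "order_ge d 0" and order_ge_1: "order_ge 0 1"
  by (auto simp: order_ge_def coeff_laurent_simps coeff_laurent_1 total_degree_def split: if_splits)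

lemma order_ge_add: "order_ge d f \<Longrightarrow> order_ge d g \<Longrightarrow> order_ge d (f + g)"
  unfolding order_ge_def coeff_laurent_simps by (metis add_0)

lemma order_ge_uminus: "order_ge d f \<Longrightarrow> order_ge d (- f)"
  by (simp add: order_ge_def coeff_laurent_simps)

lemma order_ge_diff: "order_ge d f \<Longrightarrow> order_ge d g \<Longrightarrow> order_ge d (f - g)"
  using order_ge_add[of d f "- g"] order_ge_uminus[of d g] by simp

lemma order_ge_sum: "(\<And>i. i \<in> S \<Longrightarrow> order_ge d (f i)) \<Longrightarrow> order_ge d (sum f S)"
  by (induction S rule: infinite_finite_induct) (auto simp: order_ge_0 order_ge_add)

lemma order_ge_mult:
  assumes "order_ge d f" "order_ge e g" shows "order_ge (d + e) (f * g)"
  unfolding order_ge_def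
proof (intro allI impI)
  fix m assume "coeff_laurent (f * g) m \<noteq> 0"
  then obtain i where "coeff_laurent f i \<noteq> 0" "coeff_laurent g (m - i) \<noteq> 0"
    by (rule coeff_mult_nonzero)
  then have "total_degree i \<le> - int d" "total_degree (m - i) \<le> - int e"
    using assms unfolding order_ge_def by blast+
  then show "total_degree m \<le> - int (d + e)"
    using total_degree_add[of i "m - i"] by simp
qed

lemma order_ge_mult_left: "order_ge 0 f \<Longrightarrow> order_ge d g \<Longrightarrow> order_ge d (f * g)"
  using order_ge_mult[of 0 f d g] by simp

lemma order_ge_mult_right: "order_ge d f \<Longrightarrow> order_ge 0 g \<Longrightarrow> order_ge d (f * g)"
  using order_ge_mult[of d f 0 g] by simp

lemma order_ge_mono: "order_ge d f \<Longrightarrow> e \<le> d \<Longrightarrow> order_ge e f"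
  unfolding order_ge_def by force

lemma order_ge_prod: "(\<And>i. i \<in> S \<Longrightarrow> order_ge 0 (f i)) \<Longrightarrow> order_ge 0 (prod f S)"
  by (induction S rule: infinite_finite_induct) (auto simp: order_ge_1 order_ge_mult_left)

lemma order_ge_of_nat: "order_ge 0 (of_nat k)"
  by (induction k) (simp_all add: order_ge_0 order_ge_1 order_ge_add)

lemma order_ge_prod_diff:
  assumes "\<And>i. i \<in> S \<Longrightarrow> order_ge 0 (f i)" "\<And>i. i \<in> S \<Longrightarrow> order_ge 0 (g i)"
    and "\<And>i. i \<in> S \<Longrightarrow> order_ge d (f i - g i)"
  shows "order_ge d (prod f S - prod g S)"
  using assms
proof (induction S rule: infinite_finite_induct)
  case (insert x S)
  have "prod f (insert x S) - prod g (insert x S) =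
      (f x - g x) * prod f S + g x * (prod f S - prod g S)"
    using insert.hyps by (simp add: algebra_simps)
  also have "order_ge d \<dots>"
    using insert by (intro order_ge_add order_ge_mult_left order_ge_mult_right order_ge_prod) auto
  finally show ?case .
qed (simp_all add: order_ge_0)

lemma homogeneous_order_ge: "homogeneous d f \<Longrightarrow> order_ge d f"
  by (simp add: homogeneous_def order_ge_def)

lemma homogeneous_0: "homogeneous d 0" and homogeneous_1: "homogeneous 0 1"
  by (auto simp: homogeneous_def coeff_laurent_simps coeff_laurent_1 total_degree_def split: if_splits)

lemma homogeneous_add: "homogeneous d f \<Longrightarrow> homogeneous d g \<Longrightarrow> homogeneous d (f + g)"
  unfolding homogeneous_def coeff_laurent_simps by (metis add_0)

lemma homogeneous_sum: "(\<And>i. i \<in> S \<Longrightarrow> homogeneous d (f i)) \<Longrightarrow> homogeneous d (sum f S)"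
  by (induction S rule: infinite_finite_induct) (auto simp: homogeneous_0 homogeneous_add)

lemma homogeneous_mult:
  assumes "homogeneous d f" "homogeneous e g" shows "homogeneous (d + e) (f * g)"
  unfolding homogeneous_def
proof (intro allI impI)
  fix m assume "coeff_laurent (f * g) m \<noteq> 0"
  then obtain i where "coeff_laurent f i \<noteq> 0" "coeff_laurent g (m - i) \<noteq> 0"
    by (rule coeff_mult_nonzero)
  then have "total_degree i = - int d" "total_degree (m - i) = - int e"
    using assms unfolding homogeneous_def by blast+
  then show "total_degree m = - int (d + e)"
    using total_degree_add[of i "m - i"] by simp
qed

text \<open>
  The Euler operator \<open>\<Sum>a. z\<^sub>a * d / dz\<^sub>a\<close>, a derivation by \<open>euler_mult\<close>.
\<close>

lift_definition euler :: "('p::finite, 'k::comm_ring_1) laurent \<Rightarrow> ('p, 'k) laurent"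
  is "\<lambda>f m. of_int (total_degree m) * f m"
  by (metis mult_zero_right)

lemma coeff_euler: "coeff_laurent (euler f) m = of_int (total_degree m) * coeff_laurent f m"
  by transfer (rule refl)

lemma euler_add: "euler (f + g) = euler f + euler g"
  by (rule laurent_eqI) (simp add: coeff_euler coeff_laurent_simps algebra_simps)

lemma euler_0: "euler 0 = 0"
  by (rule laurent_eqI) (simp add: coeff_euler coeff_laurent_simps)

lemma euler_diff: "euler (f - g) = euler f - euler g"
  by (rule laurent_eqI) (simp add: coeff_euler coeff_laurent_simps algebra_simps)

lemma euler_uminus: "euler (- f) = - euler f"
  by (rule laurent_eqI) (simp add: coeff_euler coeff_laurent_simps)

lemma euler_1: "euler 1 = 0"
  by (rule laurent_eqI) (simp add: coeff_euler coeff_laurent_simps coeff_laurent_1 total_degree_def)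

lemma euler_sum: "euler (sum f S) = (\<Sum>i\<in>S. euler (f i))"
  by (induction S rule: infinite_finite_induct) (simp_all add: euler_0 euler_add)

lemma euler_homogeneous:
  assumes "homogeneous d f" shows "euler f = - (of_nat d * f)"
proof (rule laurent_eqI)
  fix m
  show "coeff_laurent (euler f) m = coeff_laurent (- (of_nat d * f)) m"
    using assms unfolding homogeneous_def coeff_euler coeff_laurent_simps coeff_laurent_of_nat_mult
    by (cases "coeff_laurent f m = 0") auto
qed

lemma euler_mult:
  fixes f g :: "('p::finite, 'k::comm_ring_1) laurent"
  shows "euler (f * g) = euler f * g + f * euler g"
proof (rule laurent_eqI)
  fix m :: "'p \<Rightarrow> int"
  obtain M where M: "\<forall>m. coeff_laurent f m \<noteq> 0 \<longrightarrow> m \<le> M" using coeff_laurent[of f] by blast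
  obtain N where N: "\<forall>m. coeff_laurent g m \<noteq> 0 \<longrightarrow> m \<le> N" using coeff_laurent[of g] by blast
  have M': "\<forall>m. coeff_laurent (euler f) m \<noteq> 0 \<longrightarrow> m \<le> M" using M by (metis coeff_euler mult_zero_right)
  have N': "\<forall>m. coeff_laurent (euler g) m \<noteq> 0 \<longrightarrow> m \<le> N" using N by (metis coeff_euler mult_zero_right)
  have deg: "total_degree m = total_degree i + total_degree (m - i)" for i
    using total_degree_add[of i "m - i"] by simp
  show "coeff_laurent (euler (f * g)) m = coeff_laurent (euler f * g + f * euler g) m"
    unfolding coeff_euler coeff_laurent_simps times_laurent.rep_eq
      convolve_eq_box[OF M N order.refl order.refl] convolve_eq_box[OF M' N order.refl order.refl]
      convolve_eq_box[OF M N' order.refl order.refl] sum_distrib_left sum.distrib[symmetric]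
    by (rule sum.cong[OF refl], subst deg) (simp add: algebra_simps)
qed

lemma euler_prod:
  "finite S \<Longrightarrow> euler (prod f S) = (\<Sum>i\<in>S. \<Prod>j\<in>S. if j = i then euler (f j) else f j)"
proof (induction S rule: finite_induct)
  case (insert x S)
  have "(\<Sum>i\<in>S. \<Prod>j\<in>insert x S. if j = i then euler (f j) else f j) =
      f x * (\<Sum>i\<in>S. \<Prod>j\<in>S. if j = i then euler (f j) else f j)"
    unfolding sum_distrib_left using insert.hyps by (intro sum.cong) auto
  moreover have "(\<Prod>j\<in>S. if j = x then euler (f j) else f j) = prod f S"
    using insert.hyps by (intro prod.cong) auto
  ultimately show ?case
    using insert by (simp add: euler_mult)
qed (simp add: euler_1)

section \<open>Logarithmic derivative of a determinant\<close>

definition mat_trace :: "'a::comm_monoid_add mat \<Rightarrow> 'a" where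
  "mat_trace X = (\<Sum>i<dim_row X. X $$ (i, i))"

lemma mat_trace_add:
  "X \<in> carrier_mat d d \<Longrightarrow> Y \<in> carrier_mat d d \<Longrightarrow> mat_trace (X + Y) = mat_trace X + mat_trace Y"
  by (auto simp: mat_trace_def sum.distrib)

lemma mat_trace_smult:
  "X \<in> carrier_mat d d \<Longrightarrow> mat_trace (c \<cdot>\<^sub>m X) = c * mat_trace X" for c :: "'a::comm_semiring_0"
  by (auto simp: mat_trace_def sum_distrib_left)

lemma mat_trace_mult_comm:
  fixes X Y :: "'a::comm_semiring_0 mat"
  assumes "X \<in> carrier_mat d e" "Y \<in> carrier_mat e d"
  shows "mat_trace (X * Y) = mat_trace (Y * X)"
proof -
  have "mat_trace (X * Y) = (\<Sum>i<d. \<Sum>j<e. X $$ (i, j) * Y $$ (j, i))"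
    using assms by (auto simp: mat_trace_def scalar_prod_def lessThan_atLeast0)
  also have "\<dots> = (\<Sum>j<e. \<Sum>i<d. Y $$ (j, i) * X $$ (i, j))"
    by (subst sum.swap) (simp add: mult.commute)
  also have "\<dots> = mat_trace (Y * X)"
    using assms by (auto simp: mat_trace_def scalar_prod_def lessThan_atLeast0)
  finally show ?thesis .
qed

lemma euler_signof_mult: "euler (signof p * f) = signof p * euler f"
  by (cases p rule: sign_cases) (simp_all add: euler_uminus)

lemma order_ge_signof_mult: "order_ge d f \<Longrightarrow> order_ge d (signof p * f)"
  by (cases p rule: sign_cases) (simp_all add: order_ge_uminus)

lemma order_ge_det_diff:
  assumes "X \<in> carrier_mat d d" "Y \<in> carrier_mat d d"
    and "\<And>i j. i < d \<Longrightarrow> j < d \<Longrightarrow> order_ge 0 (X $$ (i, j))"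
    and "\<And>i j. i < d \<Longrightarrow> j < d \<Longrightarrow> order_ge 0 (Y $$ (i, j))"
    and "\<And>i j. i < d \<Longrightarrow> j < d \<Longrightarrow> order_ge e (X $$ (i, j) - Y $$ (i, j))"
  shows "order_ge e (det X - det Y)"
proof -
  have "det X - det Y = (\<Sum>p | p permutes {0..<d}.
      signof p * ((\<Prod>i = 0..<d. X $$ (i, p i)) - (\<Prod>i = 0..<d. Y $$ (i, p i))))"
    by (simp add: det_def'[OF assms(1)] det_def'[OF assms(2)] sum_subtractf right_diff_distrib)
  also have "order_ge e \<dots>"
  proof (intro order_ge_sum order_ge_signof_mult order_ge_prod_diff)
    fix p i assume "p \<in> {p. p permutes {0..<d}}" "i \<in> {0..<d}"
    then have "i < d" "p i < d" using permutes_in_image[of p "{0..<d}" i] by auto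
    then show "order_ge 0 (X $$ (i, p i))" "order_ge 0 (Y $$ (i, p i))"
      "order_ge e (X $$ (i, p i) - Y $$ (i, p i))"
      using assms by blast+
  qed
  finally show ?thesis .
qed

lemma order_ge_det:
  assumes "X \<in> carrier_mat d d" "\<And>i j. i < d \<Longrightarrow> j < d \<Longrightarrow> order_ge 0 (X $$ (i, j))"
  shows "order_ge 0 (det X)"
  unfolding det_def'[OF assms(1)]
proof (intro order_ge_sum order_ge_signof_mult order_ge_prod)
  fix p i assume "p \<in> {p. p permutes {0..<d}}" "i \<in> {0..<d}"
  then have "i < d" "p i < d" using permutes_in_image[of p "{0..<d}" i] by auto
  then show "order_ge 0 (X $$ (i, p i))" using assms by blast
qed

lemma order_ge_adj_mat:
  assumes X: "X \<in> carrier_mat d d" "\<And>i j. i < d \<Longrightarrow> j < d \<Longrightarrow> order_ge 0 (X $$ (i, j))"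
    and ij: "i < d" "j < d"
  shows "order_ge 0 (adj_mat X $$ (i, j))"
proof -
  have "order_ge 0 (det (mat_delete X j i))"
  proof (rule order_ge_det[OF mat_delete_carrier[OF X(1)]])
    fix i' j' assume *: "i' < d - 1" "j' < d - 1"
    have "mat_delete X j i $$ (i', j') = X $$ (insert_index j i', insert_index i j')"
      using mat_delete_index[of X "d - 1" j i i' j'] X(1) ij * by simp
    then show "order_ge 0 (mat_delete X j i $$ (i', j'))"
      using * ij by (auto intro!: X(2) simp: insert_index_def)
  qed
  then have "order_ge 0 ((-1) ^ (j + i) * det (mat_delete X j i))"
    by (cases "even (j + i)") (auto simp: order_ge_uminus)
  then show ?thesis using X(1) ij by (simp add: adj_mat_def cofactor_def)
qed

text \<open>
  Jacobi's formula. By the product rule in the Leibniz expansion, the derivative is the sum over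
  \<open>k\<close> of the determinants of \<open>X\<close> with row \<open>k\<close> differentiated; these are expanded along row \<open>k\<close>.
\<close>

lemma euler_det:
  assumes X: "X \<in> carrier_mat d d"
  shows "euler (det X) = mat_trace (adj_mat X * map_mat euler X)"
proof -
  define Y where "Y k = mat d d (\<lambda>(i, j). if i = k then euler (X $$ (i, j)) else X $$ (i, j))" for k
  have Y: "Y k \<in> carrier_mat d d" for k by (simp add: Y_def)
  have adj: "adj_mat X \<in> carrier_mat d d" "dim_row X = d" "dim_col X = d" using adj_mat[OF X] X by auto
  have "euler (det X) = (\<Sum>p | p permutes {0..<d}. signof p *
      (\<Sum>k = 0..<d. \<Prod>i = 0..<d. if i = k then euler (X $$ (i, p i)) else X $$ (i, p i)))"
    by (simp add: det_def'[OF X] euler_sum euler_signof_mult euler_prod)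
  also have "\<dots> = (\<Sum>k = 0..<d. \<Sum>p | p permutes {0..<d}. signof p *
      (\<Prod>i = 0..<d. if i = k then euler (X $$ (i, p i)) else X $$ (i, p i)))"
    by (subst sum.swap) (simp add: sum_distrib_left)
  also have "\<dots> = (\<Sum>k = 0..<d. det (Y k))"
    unfolding det_def'[OF Y]
    by (intro sum.cong prod.cong refl arg_cong2[where f = "(*)"])
       (auto simp: Y_def dest: permutes_in_image[of _ "{0..<d}"])
  also have "\<dots> = (\<Sum>k<d. \<Sum>j<d. euler (X $$ (k, j)) * cofactor X k j)"
    unfolding lessThan_atLeast0[symmetric]
  proof (rule sum.cong[OF refl])
    fix k assume "k \<in> {..<d}"
    then have k: "k < d" by simp
    have "mat_delete (Y k) k j = mat_delete X k j" for j
      using X by (auto simp: mat_delete_def Y_def intro!: eq_matI)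
    then show "det (Y k) = (\<Sum>j<d. euler (X $$ (k, j)) * cofactor X k j)"
      using k by (simp add: laplace_expansion_row[OF Y k] cofactor_def) (simp add: Y_def)
  qed
  also have "\<dots> = (\<Sum>j<d. \<Sum>k<d. cofactor X k j * euler (X $$ (k, j)))"
    by (subst sum.swap) (simp add: mult.commute)
  also have "\<dots> = mat_trace (adj_mat X * map_mat euler X)"
    using adj X by (simp add: mat_trace_def scalar_prod_def lessThan_atLeast0 adj_mat_def)
  finally show ?thesis .
qed

lemma pow_mat_commute:
  "N \<in> carrier_mat d d \<Longrightarrow> N * N ^\<^sub>m k = N ^\<^sub>m Suc k" for N :: "'a::semiring_1 mat"
proof (induction k)
  case (Suc k)
  then show ?case by (simp flip: assoc_mult_mat[of N d d "N ^\<^sub>m k" d N d])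
qed simp

text \<open>
  Since \<open>adj B * B = det B\<close>, the adjugate of \<open>B = 1 - N\<close> plays the part of
  \<open>det B * (1 + N + N\<^sup>2 + \<dots>)\<close>. The geometric series is cut off, and the remainder kept, so that no
  inverse of \<open>B\<close> is needed.
\<close>

lemma adj_mat_power_trace:
  fixes N :: "'a::comm_ring_1 mat"
  assumes N: "N \<in> carrier_mat d d"
  defines "B \<equiv> 1\<^sub>m d - N"
  shows "mat_trace (adj_mat B * N) =
    det B * (\<Sum>j = 1..J. mat_trace (N ^\<^sub>m j)) + mat_trace (adj_mat B * N ^\<^sub>m Suc J)"
proof (induction J)
  case 0
  then show ?case using N by simp
next
  case (Suc J)
  have B: "B \<in> carrier_mat d d" unfolding B_def by (rule minus_carrier_mat[OF N])
  note adj = adj_mat[OF B]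
  have pow: "N ^\<^sub>m k \<in> carrier_mat d d" for k using N by (rule pow_carrier_mat)
  define P where "P = N ^\<^sub>m Suc J"
  have P: "P \<in> carrier_mat d d" unfolding P_def by (rule pow)
  have comm: "N * P = N ^\<^sub>m Suc (Suc J)"
    unfolding P_def by (rule pow_mat_commute[OF N])
  have "adj_mat B * P = adj_mat B * (B * P + N * P)"
  proof -
    have "B * P + N * P = (B + N) * P" using B N P by (simp add: add_mult_distrib_mat)
    also have "B + N = 1\<^sub>m d" unfolding B_def using N by auto
    finally show ?thesis using P by simp
  qed
  also have "\<dots> = adj_mat B * (B * P) + adj_mat B * (N * P)"
    using adj(1) B N P by (intro mult_add_distrib_mat) auto
  also have "adj_mat B * (B * P) = det B \<cdot>\<^sub>m P"
    using adj B P mult_smult_assoc_mat[OF one_carrier_mat P, of "det B"]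
    by (simp flip: assoc_mult_mat)
  finally have "mat_trace (adj_mat B * P) = det B * mat_trace P + mat_trace (adj_mat B * (N * P))"
    using adj B N P by (simp add: mat_trace_add[of _ d] mat_trace_smult[of _ d])
  then show ?case
    using Suc by (simp add: P_def[symmetric] comm[symmetric] algebra_simps del: pow_mat.simps)
qed

lemma homogeneous_pow_mat:
  assumes N: "N \<in> carrier_mat d d" "\<And>i j. i < d \<Longrightarrow> j < d \<Longrightarrow> homogeneous l (N $$ (i, j))"
  shows "i < d \<Longrightarrow> j < d \<Longrightarrow> homogeneous (k * l) ((N ^\<^sub>m k) $$ (i, j))"
proof (induction k arbitrary: i j)
  case 0
  then show ?case using N by (simp add: homogeneous_0 homogeneous_1)
next
  case (Suc k)
  have pow: "N ^\<^sub>m k \<in> carrier_mat d d" using N(1) by (rule pow_carrier_mat)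
  have "(N ^\<^sub>m Suc k) $$ (i, j) = (\<Sum>r<d. (N ^\<^sub>m k) $$ (i, r) * N $$ (r, j))"
    using pow N(1) Suc.prems by (simp add: scalar_prod_def lessThan_atLeast0)
  also have "homogeneous (k * l + l) \<dots>"
    using Suc N(2) by (intro homogeneous_sum homogeneous_mult) auto
  finally show ?case by (simp add: add.commute)
qed

lemma order_ge_trace_mult:
  assumes "X \<in> carrier_mat d d" "Y \<in> carrier_mat d d"
    and "\<And>i j. i < d \<Longrightarrow> j < d \<Longrightarrow> order_ge 0 (X $$ (i, j))"
    and "\<And>i j. i < d \<Longrightarrow> j < d \<Longrightarrow> order_ge e (Y $$ (i, j))"
  shows "order_ge e (mat_trace (X * Y))"
proof -
  have "mat_trace (X * Y) = (\<Sum>i<d. \<Sum>j<d. X $$ (i, j) * Y $$ (j, i))"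
    using assms by (auto simp: mat_trace_def scalar_prod_def lessThan_atLeast0)
  also have "order_ge e \<dots>"
    using assms by (intro order_ge_sum order_ge_mult_left) auto
  finally show ?thesis .
qed

lemma one_minus_homogeneous:
  assumes N: "N \<in> carrier_mat d d" "\<And>i j. i < d \<Longrightarrow> j < d \<Longrightarrow> homogeneous l (N $$ (i, j))"
  shows "\<And>i j. i < d \<Longrightarrow> j < d \<Longrightarrow> order_ge 0 ((1\<^sub>m d - N) $$ (i, j))"
    and "order_ge 0 (det (1\<^sub>m d - N))" and "order_ge l (det (1\<^sub>m d - N) - 1)"
proof -
  have one: "order_ge 0 ((1\<^sub>m d :: (_, _) laurent mat) $$ (i, j))" if "i < d" "j < d" for i j
    using that by (simp add: order_ge_0 order_ge_1)
  show *: "order_ge 0 ((1\<^sub>m d - N) $$ (i, j))" if "i < d" "j < d" for i j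
    using that N(1) order_ge_diff[OF one[OF that] order_ge_mono[OF homogeneous_order_ge[OF N(2)[OF that]]]]
    by auto
  show "order_ge 0 (det (1\<^sub>m d - N))"
    using N(1) by (intro order_ge_det[of _ d] *) auto
  have "order_ge l (det (1\<^sub>m d - N) - det (1\<^sub>m d))"
  proof (rule order_ge_det_diff[OF _ _ * one])
    fix i j assume "i < d" "j < d"
    then show "order_ge l ((1\<^sub>m d - N) $$ (i, j) - 1\<^sub>m d $$ (i, j))"
      using N order_ge_uminus[OF homogeneous_order_ge[OF N(2)]] by auto
  qed (use N(1) in auto)
  then show "order_ge l (det (1\<^sub>m d - N) - 1)" by simp
qed

text \<open>
  Homogeneity gives \<open>E (1 - N) = l * N\<close>, so Jacobi's formula turns \<open>E (det (1 - N))\<close> into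
  \<open>l * tr (adj (1 - N) * N)\<close>. The remainder in \<open>adj_mat_power_trace\<close> contains \<open>N ^ (J + 1)\<close>, whose
  entries have degree \<open>- (J + 1) * l\<close>.
\<close>

lemma log_derivative_det:
  assumes N: "N \<in> carrier_mat d d" "\<And>i j. i < d \<Longrightarrow> j < d \<Longrightarrow> homogeneous l (N $$ (i, j))"
  shows "order_ge (Suc J * l) (euler (det (1\<^sub>m d - N)) -
    det (1\<^sub>m d - N) * (of_nat l * (\<Sum>j = 1..J. mat_trace (N ^\<^sub>m j))))"
proof -
  define B where "B = 1\<^sub>m d - N"
  have B: "B \<in> carrier_mat d d" unfolding B_def by (rule minus_carrier_mat[OF N(1)])
  note adj = adj_mat[OF B]
  have "map_mat euler B = of_nat l \<cdot>\<^sub>m N"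
    using N(1) by (intro eq_matI)
      (auto simp: B_def euler_diff euler_homogeneous[OF N(2)] euler_1 euler_0)
  then have "euler (det B) = of_nat l * mat_trace (adj_mat B * N)"
    using euler_det[OF B] adj N(1) by (simp add: mult_smult_distrib[of _ d d] mat_trace_smult[of _ d])
  then have "euler (det B) - det B * (of_nat l * (\<Sum>j = 1..J. mat_trace (N ^\<^sub>m j))) =
      of_nat l * mat_trace (adj_mat B * N ^\<^sub>m Suc J)"
    using adj_mat_power_trace[OF N(1), of J] by (simp add: B_def algebra_simps)
  moreover have "order_ge (Suc J * l) (mat_trace (adj_mat B * N ^\<^sub>m Suc J))"
  proof (rule order_ge_trace_mult[OF adj(1) pow_carrier_mat[OF N(1)]])
    show "order_ge 0 (adj_mat B $$ (i, j))" if "i < d" "j < d" for i j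
      using one_minus_homogeneous(1)[OF N] that unfolding B_def[symmetric]
      by (intro order_ge_adj_mat[OF B]) auto
    show "order_ge (Suc J * l) ((N ^\<^sub>m Suc J) $$ (i, j))" if "i < d" "j < d" for i j
      using homogeneous_pow_mat[OF N that] by (rule homogeneous_order_ge)
  qed
  ultimately show ?thesis
    unfolding B_def by (simp only: order_ge_mult_left[OF order_ge_of_nat])
qed

text \<open>
  In \<open>log_derivative_prod\<close> and \<open>log_derivative_unique\<close>, a bound on \<open>euler f - f * s\<close> says that \<open>s\<close>
  is the logarithmic derivative \<open>euler f / f\<close> up to the given order, with no division by \<open>f\<close>.
\<close>

lemma log_derivative_prod:
  assumes "finite S" "\<And>i. i \<in> S \<Longrightarrow> order_ge 0 (f i)"
    and "\<And>i. i \<in> S \<Longrightarrow> order_ge d (euler (f i) - f i * g i)"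
  shows "order_ge d (euler (prod f S) - prod f S * sum g S)"
  using assms
proof (induction S rule: finite_induct)
  case (insert x S)
  have "euler (prod f (insert x S)) - prod f (insert x S) * sum g (insert x S) =
      (euler (f x) - f x * g x) * prod f S + f x * (euler (prod f S) - prod f S * sum g S)"
    using insert.hyps by (simp add: euler_mult algebra_simps)
  also have "order_ge d \<dots>"
    using insert by (intro order_ge_add order_ge_mult_left order_ge_mult_right order_ge_prod) auto
  finally show ?case .
qed (simp add: euler_1 order_ge_0)

text \<open>
  The difference \<open>f - g\<close> satisfies \<open>E (f - g) = (f - g) * s\<close> up to order \<open>d\<close>, and \<open>s\<close> has positive
  order. So if \<open>f - g\<close> has order at least \<open>i\<close>, then \<open>E (f - g)\<close> has order at least \<open>i + 1\<close> (or
  \<open>d\<close>), and so has \<open>f - g\<close>: it has no term of total degree 0, so \<open>E\<close> multiplies its coefficients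
  by nonzero integers. Characteristic 0 enters here.
\<close>

lemma log_derivative_unique:
  fixes f g :: "('p::finite, 'k::field_char_0) laurent"
  assumes f: "order_ge d (euler f - f * s)" and g: "order_ge d (euler g - g * s)"
    and s: "order_ge 1 s" and fg: "order_ge 1 (f - g)"
  shows "order_ge d (f - g)"
proof -
  have "order_ge (min d (Suc i)) (f - g)" for i
  proof (induction i)
    case 0
    show ?case using fg by (rule order_ge_mono) simp
  next
    case (Suc i)
    have "euler (f - g) = (euler f - f * s) - (euler g - g * s) + (f - g) * s"
      by (simp add: euler_diff algebra_simps)
    also have "order_ge (min d (Suc (Suc i))) \<dots>"
    proof (intro order_ge_add)
      show "order_ge (min d (Suc (Suc i))) (euler f - f * s - (euler g - g * s))"
        by (rule order_ge_mono[OF order_ge_diff[OF f g]]) simp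
      show "order_ge (min d (Suc (Suc i))) ((f - g) * s)"
        by (rule order_ge_mono[OF order_ge_mult[OF Suc s]]) simp
    qed
    finally have E: "order_ge (min d (Suc (Suc i))) (euler (f - g))" .
    show ?case
      unfolding order_ge_def
    proof (intro allI impI)
      fix m assume m: "coeff_laurent (f - g) m \<noteq> 0"
      then have "total_degree m \<le> - 1" using fg unfolding order_ge_def by fastforce
      then have "coeff_laurent (euler (f - g)) m \<noteq> 0"
        using m by (simp add: coeff_euler)
      then show "total_degree m \<le> - int (min d (Suc (Suc i)))"
        using E unfolding order_ge_def by blast
    qed
  qed
  from this[of d] show ?thesis by (simp add: min_def split: if_splits)
qed

section \<open>Products of blocks along paths\<close>

abbreviation offset :: "('p::linorder \<Rightarrow> nat) \<Rightarrow> 'p \<Rightarrow> nat" where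
  "offset n a \<equiv> sum n {..<a}"

lemma offset_less:
  fixes n :: "'p::{finite,linorder} \<Rightarrow> nat"
  assumes "a < b" shows "offset n a + n a \<le> offset n b"
proof -
  have "offset n a + n a = sum n (insert a {..<a})" by simp
  also have "\<dots> \<le> offset n b" using assms by (intro sum_mono2) auto
  finally show ?thesis .
qed

lemma offset_le_total:
  fixes n :: "'p::{finite,linorder} \<Rightarrow> nat"
  shows "offset n a + n a \<le> sum n UNIV"
proof -
  have "offset n a + n a = sum n (insert a {..<a})" by simp
  also have "\<dots> \<le> sum n UNIV" by (intro sum_mono2) auto
  finally show ?thesis .
qed

lemma offset_eq_iff:
  fixes n :: "'p::{finite,linorder} \<Rightarrow> nat"
  assumes "i < n a" "j < n b"
  shows "offset n a + i = offset n b + j \<longleftrightarrow> a = b \<and> i = j"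
  using assms offset_less[of a b n] offset_less[of b a n] by (cases a b rule: linorder_cases) auto

lemma bij_betw_offset:
  fixes n :: "'p::{finite,linorder} \<Rightarrow> nat"
  shows "bij_betw (\<lambda>(a, i). offset n a + i) (SIGMA a:UNIV. {..<n a}) {..<sum n UNIV}"
proof -
  let ?f = "\<lambda>(a, i). offset n a + i" and ?S = "SIGMA a:UNIV. {..<n a}"
  have inj: "inj_on ?f ?S" by (auto simp: inj_on_def offset_eq_iff)
  moreover have "?f ` ?S = {..<sum n UNIV}"
  proof (rule card_subset_eq)
    show "?f ` ?S \<subseteq> {..<sum n UNIV}"
    proof clarsimp
      fix a i assume "i < n a"
      then show "offset n a + i < sum n UNIV" using offset_le_total[of n a] by linarith
    qed
    show "card (?f ` ?S) = card {..<sum n UNIV}"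
      by (simp add: card_image[OF inj] card_SigmaI)
  qed simp
  ultimately show ?thesis by (simp add: bij_betw_def)
qed

lemma sum_blocks:
  fixes n :: "'p::{finite,linorder} \<Rightarrow> nat" and f :: "nat \<Rightarrow> 'a::comm_monoid_add"
  shows "(\<Sum>r<sum n UNIV. f r) = (\<Sum>a\<in>UNIV. \<Sum>i<n a. f (offset n a + i))"
  using sum.reindex_bij_betw[OF bij_betw_offset[of n], of f]
  by (simp add: sum.Sigma case_prod_beta)

lemma prod_blocks:
  fixes n :: "'p::{finite,linorder} \<Rightarrow> nat" and f :: "nat \<Rightarrow> 'a::comm_monoid_mult"
  shows "(\<Prod>r<sum n UNIV. f r) = (\<Prod>a\<in>UNIV. \<Prod>i<n a. f (offset n a + i))"
  using prod.reindex_bij_betw[OF bij_betw_offset[of n], of f]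
  by (simp add: prod.Sigma case_prod_beta)

lemma block_index_cases:
  fixes n :: "'p::{finite,linorder} \<Rightarrow> nat"
  assumes "r < sum n UNIV"
  obtains a i where "i < n a" "r = offset n a + i"
proof -
  have "r \<in> (\<lambda>(a, i). offset n a + i) ` (SIGMA a:UNIV. {..<n a})"
    unfolding bij_betw_imp_surj_on[OF bij_betw_offset] using assms by simp
  then show thesis using that by auto
qed

definition block_of :: "('p::{finite,linorder} \<Rightarrow> nat) \<Rightarrow> nat \<Rightarrow> 'p" where
  "block_of n r = (THE a. \<exists>i<n a. r = offset n a + i)"

lemma block_of_offset: "i < n a \<Longrightarrow> block_of n (offset n a + i) = a"
  unfolding block_of_def by (rule the_equality) (auto simp: offset_eq_iff)

lemma block_carrier: "block n A a b \<in> carrier_mat (n a) (n b)"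
  by (simp add: block_def)

lemma block_index:
  "i < n a \<Longrightarrow> j < n b \<Longrightarrow> block n A a b $$ (i, j) = A $$ (offset n a + i, offset n b + j)"
  by (simp add: block_def)

text \<open>
  The list holds the letters visited after \<open>a\<close>. A closed walk \<open>a # as\<close> is the path \<open>as @ [a]\<close> from
  \<open>a\<close> (\<open>walk_mat_Cons\<close>); unlike closed walks, paths can be cut and joined, and they allow
  induction on the list.
\<close>

fun path_mat :: "('p::linorder \<Rightarrow> nat) \<Rightarrow> 'r::semiring_1 mat \<Rightarrow> 'p \<Rightarrow> 'p list \<Rightarrow> 'r mat" where
  "path_mat n A a [] = 1\<^sub>m (n a)"
| "path_mat n A a (b # bs) = block n A a b * path_mat n A b bs"

lemma path_mat_carrier: "path_mat n A a bs \<in> carrier_mat (n a) (n (last (a # bs)))"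
proof (induction bs arbitrary: a)
  case (Cons b bs)
  show ?case using mult_carrier_mat[OF block_carrier[of n A a b] Cons.IH[of b]] by simp
qed simp

lemma path_mat_dim: "dim_row (path_mat n A a bs) = n a"
  using path_mat_carrier[of n A a bs] by blast

lemma path_mat_append:
  "path_mat n A a (bs @ cs) = path_mat n A a bs * path_mat n A (last (a # bs)) cs"
proof (induction bs arbitrary: a)
  case Nil
  show ?case using left_mult_one_mat[OF path_mat_carrier[of n A a cs]] by simp
next
  case (Cons b bs)
  show ?case
    using Cons[of b] assoc_mult_mat[OF block_carrier[of n A a b] path_mat_carrier[of n A b bs]
        path_mat_carrier[of n A "last (b # bs)" cs]]
    by simp
qed

lemma walk_mat_Cons: "walk_mat n A (a # as) = path_mat n A a (as @ [a])"
proof -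
  have "foldr (\<lambda>(a, b) X. block n A a b * X) (zip (a # as) (as @ [c])) (1\<^sub>m (n c)) =
      path_mat n A a (as @ [c])" for c
    by (induction as arbitrary: a) auto
  then show ?thesis by (simp add: walk_mat_def)
qed

lemma walk_mat_carrier: "w \<noteq> [] \<Longrightarrow> walk_mat n A w \<in> carrier_mat (n (hd w)) (n (hd w))"
  using path_mat_carrier[of n A "hd w" "tl w @ [hd w]"] by (cases w) (simp_all add: walk_mat_Cons)

lemma walk_mat_word_power:
  assumes "w \<noteq> []" "0 < j" shows "walk_mat n A (word_power w j) = walk_mat n A w ^\<^sub>m j"
proof (cases w)
  case (Cons a as)
  have "path_mat n A a (word_power (as @ [a]) j) = path_mat n A a (as @ [a]) ^\<^sub>m j" for j
  proof (induction j)
    case 0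
    show ?case using path_mat_carrier[of n A a "as @ [a]"] by simp
  next
    case (Suc j)
    have "path_mat n A a (word_power (as @ [a]) (Suc j)) =
        path_mat n A a (as @ [a]) * path_mat n A a (word_power (as @ [a]) j)"
      using path_mat_append[of n A a "as @ [a]" "word_power (as @ [a]) j"] by simp
    also have "\<dots> = path_mat n A a (as @ [a]) ^\<^sub>m Suc j"
      unfolding Suc.IH using path_mat_carrier[of n A a "as @ [a]"]
      by (intro pow_mat_commute) simp
    finally show ?case .
  qed
  moreover obtain bs where bs: "word_power w j = a # bs" using assms Cons by (cases j) auto
  moreover have "bs @ [a] = word_power (as @ [a]) j"
    using rotate1_word_power[of j w] unfolding bs by (simp add: Cons)
  ultimately show ?thesis by (simp add: Cons walk_mat_Cons)
qed (use assms in simp)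

text \<open>
  Moving the first letter to the end turns a product \<open>X * Y\<close> into \<open>Y * X\<close>; both factors are
  rectangular in general.
\<close>

lemma trace_walk_mat_rotate:
  fixes A :: "'r::comm_semiring_1 mat"
  assumes "w \<noteq> []" shows "mat_trace (walk_mat n A (rotate i w)) = mat_trace (walk_mat n A w)"
proof -
  have rotate1: "mat_trace (walk_mat n A (rotate1 w)) = mat_trace (walk_mat n A w)"
    if "w \<noteq> []" for w
  proof (cases w)
    case Nil then show ?thesis using that by simp
  next
    case w: (Cons a as)
    show ?thesis
    proof (cases as)
      case Nil
      then show ?thesis using w by simp
    next
      case (Cons b bs)
      have X: "path_mat n A a [b] \<in> carrier_mat (n a) (n b)"
        and Y: "path_mat n A b (bs @ [a]) \<in> carrier_mat (n b) (n a)"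
        using path_mat_carrier[of n A a "[b]"] path_mat_carrier[of n A b "bs @ [a]"] by simp_all
      have "walk_mat n A w = path_mat n A a [b] * path_mat n A b (bs @ [a])"
        using path_mat_append[of n A a "[b]" "bs @ [a]"] by (simp add: w Cons walk_mat_Cons)
      moreover have "walk_mat n A (rotate1 w) = path_mat n A b (bs @ [a]) * path_mat n A a [b]"
        using path_mat_append[of n A b "bs @ [a]" "[b]"] by (simp add: w Cons walk_mat_Cons)
      ultimately show ?thesis
        using mat_trace_mult_comm[OF X Y] by simp
    qed
  qed
  then show ?thesis using assms by (induction i) simp_all
qed

lemma pow_mat_index_paths:
  fixes M :: "'r::comm_ring_1 mat" and n :: "'p::{finite,linorder} \<Rightarrow> nat"
  assumes M: "M \<in> carrier_mat (sum n UNIV) (sum n UNIV)"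
    and "i < n a" and j: "j < n b"
  shows "(M ^\<^sub>m k) $$ (offset n a + i, offset n b + j) =
    (\<Sum>bs | length bs = k \<and> last (a # bs) = b. path_mat n M a bs $$ (i, j))"
  using assms(2)
proof (induction k arbitrary: a i)
  case 0
  have less: "offset n a + i < sum n UNIV" "offset n b + j < sum n UNIV"
    using offset_le_total[of n a] offset_le_total[of n b] 0 j by linarith+
  have "{bs. length bs = 0 \<and> last (a # bs) = b} = (if a = b then {[]} else {})" by auto
  then have "(\<Sum>bs | length bs = 0 \<and> last (a # bs) = b. path_mat n M a bs $$ (i, j)) =
      (if a = b \<and> i = j then 1 else 0)"
    using 0 j by (cases "a = b") auto
  then show ?case
    using M less offset_eq_iff[of i n a j b] 0 j by simp
next
  case (Suc k)
  have less: "offset n a + i < sum n UNIV" "offset n b + j < sum n UNIV"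
    using offset_le_total[of n a] offset_le_total[of n b] Suc.prems j by linarith+
  have pow: "M ^\<^sub>m k \<in> carrier_mat (sum n UNIV) (sum n UNIV)" using M by (rule pow_carrier_mat)
  have fin: "finite {bs :: 'p list. length bs = k \<and> last (c # bs) = b}" for c
    by (rule finite_subset[OF _ finite_lists_length_eq[of UNIV k]]) auto
  have step: "path_mat n M a (c # bs) $$ (i, j) =
      (\<Sum>l<n c. block n M a c $$ (i, l) * path_mat n M c bs $$ (l, j))"
    if "last (c # bs) = b" for c bs
    using block_carrier[of n M a c] path_mat_carrier[of n M c bs] that Suc.prems j
    by (simp add: scalar_prod_def lessThan_atLeast0)
  have "(M ^\<^sub>m Suc k) $$ (offset n a + i, offset n b + j) =
      (M * M ^\<^sub>m k) $$ (offset n a + i, offset n b + j)"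
    by (simp only: pow_mat_commute[OF M])
  also have "\<dots> = (\<Sum>r<sum n UNIV. M $$ (offset n a + i, r) * (M ^\<^sub>m k) $$ (r, offset n b + j))"
    using M pow less by (simp add: scalar_prod_def lessThan_atLeast0)
  also have "\<dots> = (\<Sum>c\<in>UNIV. \<Sum>l<n c. block n M a c $$ (i, l) *
      (\<Sum>bs | length bs = k \<and> last (c # bs) = b. path_mat n M c bs $$ (l, j)))"
    unfolding sum_blocks by (intro sum.cong refl) (simp add: Suc block_index)
  also have "\<dots> = (\<Sum>c\<in>UNIV. \<Sum>bs | length bs = k \<and> last (c # bs) = b.
      \<Sum>l<n c. block n M a c $$ (i, l) * path_mat n M c bs $$ (l, j))"
    unfolding sum_distrib_left by (intro sum.cong refl sum.swap)
  also have "\<dots> = (\<Sum>c\<in>UNIV. \<Sum>bs | length bs = k \<and> last (c # bs) = b. path_mat n M a (c # bs) $$ (i, j))"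
    by (intro sum.cong refl) (simp only: step mem_Collect_eq)
  also have "\<dots> = (\<Sum>(c, bs)\<in>(SIGMA c:UNIV. {bs. length bs = k \<and> last (c # bs) = b}).
      path_mat n M a (c # bs) $$ (i, j))"
    using fin by (intro sum.Sigma) auto
  also have "\<dots> = (\<Sum>bs | length bs = Suc k \<and> last (a # bs) = b. path_mat n M a bs $$ (i, j))"
    by (rule sum.reindex_bij_witness[of _ "\<lambda>bs. (hd bs, tl bs)" "\<lambda>(c, bs). c # bs"])
       (auto simp: length_Suc_conv)
  finally show ?case .
qed

text \<open>
  An entry of \<open>M ^ k\<close> is a sum over paths with \<open>k\<close> steps (\<open>pow_mat_index_paths\<close>), and the trace
  selects the paths that return to their starting point.
\<close>

lemma trace_pow_mat:
  fixes M :: "'r::comm_ring_1 mat" and n :: "'p::{finite,linorder} \<Rightarrow> nat"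
  assumes M: "M \<in> carrier_mat (sum n UNIV) (sum n UNIV)" and k: "0 < k"
  shows "mat_trace (M ^\<^sub>m k) = (\<Sum>w | length w = k. mat_trace (walk_mat n M w))"
proof -
  have fin: "finite {bs :: 'p list. length bs = k \<and> last (a # bs) = a}" for a
    by (rule finite_subset[OF _ finite_lists_length_eq[of UNIV k]]) auto
  have "mat_trace (M ^\<^sub>m k) = (\<Sum>a\<in>UNIV. \<Sum>i<n a.
      \<Sum>bs | length bs = k \<and> last (a # bs) = a. path_mat n M a bs $$ (i, i))"
    using M unfolding mat_trace_def by (simp add: sum_blocks pow_mat_index_paths)
  also have "\<dots> = (\<Sum>a\<in>UNIV. \<Sum>bs | length bs = k \<and> last (a # bs) = a. mat_trace (path_mat n M a bs))"
    by (subst sum.swap) (simp add: mat_trace_def path_mat_dim)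
  also have "\<dots> = (\<Sum>(a, bs)\<in>(SIGMA a:UNIV. {bs. length bs = k \<and> last (a # bs) = a}).
      mat_trace (path_mat n M a bs))"
    using fin by (intro sum.Sigma) auto
  also have "\<dots> = (\<Sum>w | length w = k. mat_trace (walk_mat n M w))"
  proof (rule sum.reindex_bij_witness[of _ "\<lambda>w. (hd w, tl w @ [hd w])" "\<lambda>(a, bs). a # butlast bs"])
    fix x assume "x \<in> (SIGMA a:UNIV. {bs :: 'p list. length bs = k \<and> last (a # bs) = a})"
    then obtain a bs where x: "x = (a, bs @ [a])" "length (bs @ [a]) = k"
      using k by (cases x, cases "snd x" rule: rev_cases) auto
    then show "(hd (case x of (a, bs) \<Rightarrow> a # butlast bs), tl (case x of (a, bs) \<Rightarrow> a # butlast bs) @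
        [hd (case x of (a, bs) \<Rightarrow> a # butlast bs)]) = x"
      "(case x of (a, bs) \<Rightarrow> a # butlast bs) \<in> {w. length w = k}"
      "mat_trace (walk_mat n M (case x of (a, bs) \<Rightarrow> a # butlast bs)) =
        (case x of (a, bs) \<Rightarrow> mat_trace (path_mat n M a bs))"
      by (simp_all add: walk_mat_Cons)
  next
    fix w :: "'p list" assume "w \<in> {w. length w = k}"
    then show "(case (hd w, tl w @ [hd w]) of (a, bs) \<Rightarrow> a # butlast bs) = w"
      "(hd w, tl w @ [hd w]) \<in> (SIGMA a:UNIV. {bs. length bs = k \<and> last (a # bs) = a})"
      using k by (cases w; simp)+
  qed
  finally show ?thesis .
qed

text \<open>
  A nonempty word that is not a closed walk, the one-letter words included, has two equal
  cyclically successive letters and thus a diagonal block as a factor.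
\<close>

lemma walk_mat_not_closed:
  fixes M :: "'r::comm_ring_1 mat"
  assumes diag: "\<And>a. block n M a a = 0\<^sub>m (n a) (n a)" and w: "w \<noteq> []" "\<not> closed_walk w"
  shows "walk_mat n M w = 0\<^sub>m (n (hd w)) (n (hd w))"
proof -
  have zero: "path_mat n M a bs = 0\<^sub>m (n a) (n (last (a # bs)))"
    if "(c, c) \<in> set (zip (a # bs) bs)" for a bs c
    using that
  proof (induction bs arbitrary: a)
    case (Cons b bs)
    show ?case
    proof (cases "a = b")
      case True
      then show ?thesis
        using left_mult_zero_mat[OF path_mat_carrier[of n M b bs]] by (simp add: diag)
    next
      case False
      then show ?thesis
        using Cons right_mult_zero_mat[OF block_carrier[of n M a b]] by auto
    qed
  qed simp
  obtain a as where as: "w = a # as" using w by (cases w) auto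
  have "\<exists>c. (c, c) \<in> set (zip (a # as) (as @ [a]))"
  proof (cases "as = []")
    case False
    then have "2 \<le> length w" by (cases as) (simp_all add: as)
    then show ?thesis using w(2) by (auto simp: closed_walk_def as)
  qed auto
  then obtain c where "(c, c) \<in> set (zip (a # as) (as @ [a]))" by blast
  moreover have "zip (a # as) (as @ [a]) = zip (a # (as @ [a])) (as @ [a])"
    using zip_append[of "a # as" "as @ [a]" "[a]" "[]"] by simp
  ultimately show ?thesis
    using zero[of c a "as @ [a]"] by (simp add: as walk_mat_Cons)
qed

lemma walk_mat_scale:
  fixes A M :: "'r::comm_ring_1 mat" and c :: "'p::linorder \<Rightarrow> 'r"
  assumes M: "\<And>a b. a \<noteq> b \<Longrightarrow> block n M a b = c a \<cdot>\<^sub>m block n A a b" and w: "closed_walk w"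
  shows "walk_mat n M w = prod_list (map c w) \<cdot>\<^sub>m walk_mat n A w"
proof -
  have path: "path_mat n M a (as @ [b]) = prod_list (map c (a # as)) \<cdot>\<^sub>m path_mat n A a (as @ [b])"
    if "\<forall>(x, y) \<in> set (zip (a # as) (as @ [b])). x \<noteq> y" for a as b
    using that
  proof (induction as arbitrary: a)
    case Nil
    then show ?case using block_carrier[of n A a b] M[of a b] by simp
  next
    case (Cons x as)
    have X: "block n A a x \<in> carrier_mat (n a) (n x)" by (rule block_carrier)
    have Y: "path_mat n A x (as @ [b]) \<in> carrier_mat (n x) (n b)"
      using path_mat_carrier[of n A x "as @ [b]"] by simp
    have "path_mat n M a ((x # as) @ [b]) =
        c a \<cdot>\<^sub>m block n A a x * (prod_list (map c (x # as)) \<cdot>\<^sub>m path_mat n A x (as @ [b]))"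
      using Cons M[of a x] by simp
    also have "\<dots> = c a \<cdot>\<^sub>m (prod_list (map c (x # as)) \<cdot>\<^sub>m (block n A a x * path_mat n A x (as @ [b])))"
      using mult_smult_assoc_mat[OF X smult_carrier_mat[OF Y]] mult_smult_distrib[OF X Y] by metis
    also have "\<dots> = prod_list (map c (a # x # as)) \<cdot>\<^sub>m path_mat n A a ((x # as) @ [b])"
      by (intro eq_matI) (auto simp: mult.assoc)
    finally show ?case .
  qed
  obtain a as where as: "w = a # as" using closed_walk_nonempty[OF w] by (cases w) auto
  show ?thesis
    using path[of a as a] w by (simp add: as walk_mat_Cons closed_walk_def)
qed

lemma homogeneous_walk_mat:
  fixes M :: "('p::{finite,linorder}, 'k::comm_ring_1) laurent mat"
  assumes M: "\<And>a b i j. i < n a \<Longrightarrow> j < n b \<Longrightarrow> homogeneous 1 (block n M a b $$ (i, j))"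
    and w: "w \<noteq> []" "i < n (hd w)" "j < n (hd w)"
  shows "homogeneous (length w) (walk_mat n M w $$ (i, j))"
proof -
  have path: "homogeneous (length bs) (path_mat n M a bs $$ (i, j))"
    if "i < n a" "j < n (last (a # bs))" for a bs i j
    using that
  proof (induction bs arbitrary: a i)
    case Nil
    then show ?case by (simp add: homogeneous_0 homogeneous_1)
  next
    case (Cons b bs)
    have "path_mat n M a (b # bs) $$ (i, j) =
        (\<Sum>l<n b. block n M a b $$ (i, l) * path_mat n M b bs $$ (l, j))"
      using block_carrier[of n M a b] path_mat_carrier[of n M b bs] Cons.prems
      by (simp add: scalar_prod_def lessThan_atLeast0)
    also have "homogeneous (1 + length bs) \<dots>"
      using Cons by (intro homogeneous_sum homogeneous_mult M) auto
    finally show ?case by simp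
  qed
  obtain a as where as: "w = a # as" using w by (cases w) auto
  show ?thesis using path[of i a j "as @ [a]"] w by (simp add: as walk_mat_Cons)
qed

section \<open>The determinant as a product over prime cyclic walks\<close>

text \<open>
  For \<open>M\<close> homogeneous of degree \<open>- 1\<close>, the left-hand side is the logarithmic derivative of
  \<open>det (1 - M)\<close> up to order \<open>K + 1\<close>, the right-hand side that of the product of the
  \<open>det (1 - M\<^sub>c)\<close>: a prime walk of length above \<open>K\<close> contributes only from order \<open>K + 1\<close> on.
\<close>

lemma sum_trace_pow_mat:
  fixes M :: "'r::comm_ring_1 mat" and n :: "'p::{finite,linorder} \<Rightarrow> nat"
    and start :: "'p list set \<Rightarrow> 'p list"
  assumes M: "M \<in> carrier_mat (sum n UNIV) (sum n UNIV)"
    and diag: "\<And>a. block n M a a = 0\<^sub>m (n a) (n a)"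
    and start: "\<And>c. c \<in> prime_cyclic_walks \<Longrightarrow> start c \<in> c"
  shows "(\<Sum>k = 1..K. mat_trace (M ^\<^sub>m k)) =
    (\<Sum>c | c \<in> prime_cyclic_walks \<and> length (start c) \<le> K. of_nat (length (start c)) *
       (\<Sum>j = 1..K div length (start c). mat_trace (walk_mat n M (start c) ^\<^sub>m j)))"
proof -
  let ?T = "\<lambda>w. mat_trace (walk_mat n M w)"
  let ?W = "{w :: 'p list. length w \<le> K \<and> w \<noteq> []}"
  have fin: "finite ?W" by (rule finite_words_length_le)
  have "(\<Sum>k = 1..K. mat_trace (M ^\<^sub>m k)) = (\<Sum>k = 1..K. \<Sum>w | length w = k. ?T w)"
    using trace_pow_mat[OF M] by (intro sum.cong) auto
  also have "\<dots> = (\<Sum>k\<in>{1..K}. \<Sum>w\<in>{w \<in> ?W. length w = k}. ?T w)"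
    by (intro sum.cong arg_cong2[where f = sum] refl) auto
  also have "\<dots> = (\<Sum>w\<in>?W. ?T w)"
    using fin by (intro sum.group) (auto simp: Suc_le_eq)
  also have "\<dots> = (\<Sum>w | length w \<le> K \<and> closed_walk w. ?T w)"
  proof (rule sum.mono_neutral_right[OF fin])
    show "\<forall>w\<in>?W - {w. length w \<le> K \<and> closed_walk w}. ?T w = 0"
      using walk_mat_not_closed[OF diag] by (auto simp: mat_trace_def)
  qed (use closed_walk_nonempty in auto)
  also have "\<dots> = (\<Sum>c | c \<in> prime_cyclic_walks \<and> length (start c) \<le> K.
      of_nat (length (start c)) * (\<Sum>j = 1..K div length (start c). ?T (word_power (start c) j)))"
    by (rule sum_closed_walks[OF start trace_walk_mat_rotate])
  also have "\<dots> = (\<Sum>c | c \<in> prime_cyclic_walks \<and> length (start c) \<le> K.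
      of_nat (length (start c)) *
        (\<Sum>j = 1..K div length (start c). mat_trace (walk_mat n M (start c) ^\<^sub>m j)))"
  proof (rule sum.cong[OF refl])
    fix c assume "c \<in> {c. c \<in> prime_cyclic_walks \<and> length (start c) \<le> K}"
    then have "start c \<noteq> []"
      using prime_cyclic_walk_member(1)[OF _ start] closed_walk_nonempty by blast
    then show "of_nat (length (start c)) * (\<Sum>j = 1..K div length (start c). ?T (word_power (start c) j)) =
        of_nat (length (start c)) *
          (\<Sum>j = 1..K div length (start c). mat_trace (walk_mat n M (start c) ^\<^sub>m j))"
      by (simp add: walk_mat_word_power)
  qed
  finally show ?thesis .
qed

text \<open>
  Only finitely many prime walks have length at most \<open>K\<close>. Any finite product of the factors that
  includes these has the same logarithmic derivative as \<open>det (1 - M)\<close> up to order \<open>K + 1\<close>, hence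
  the same coefficients in all total degrees \<open>\<ge> - K\<close>.
\<close>

theorem det_eq_formal_prod_prime_walks:
  fixes M :: "('p::{finite,linorder}, 'k::field_char_0) laurent mat" and n :: "'p \<Rightarrow> nat"
    and start :: "'p list set \<Rightarrow> 'p list"
  assumes M: "M \<in> carrier_mat (sum n UNIV) (sum n UNIV)"
    and hom: "\<And>a b i j. i < n a \<Longrightarrow> j < n b \<Longrightarrow> homogeneous 1 (block n M a b $$ (i, j))"
    and diag: "\<And>a. block n M a a = 0\<^sub>m (n a) (n a)"
    and start: "\<And>c. c \<in> prime_cyclic_walks \<Longrightarrow> start c \<in> c"
  shows "has_formal_prod (\<lambda>c. det (1\<^sub>m (n (hd (start c))) - walk_mat n M (start c)))
    prime_cyclic_walks (det (1\<^sub>m (sum n UNIV) - M))"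
  unfolding has_formal_prod_def
proof
  fix m :: "'p \<Rightarrow> int"
  \<comment> \<open>The least order for which agreement up to order \<open>K + 1\<close> settles the coefficient of \<open>m\<close>.\<close>
  define K where "K = nat (- total_degree m)"
  define f where "f = det (1\<^sub>m (sum n UNIV) - M)"
  define h where "h c = det (1\<^sub>m (n (hd (start c))) - walk_mat n M (start c))" for c
  define S where "S = (\<Sum>k = 1..K. mat_trace (M ^\<^sub>m k))"
  define s where "s c = (of_nat (length (start c)) :: ('p, 'k) laurent) *
    (\<Sum>j = 1..K div length (start c). mat_trace (walk_mat n M (start c) ^\<^sub>m j))" for c
  let ?C = "{c. c \<in> prime_cyclic_walks \<and> length (start c) \<le> K}"
  have M_hom: "homogeneous 1 (M $$ (r, t))" if rt: "r < sum n UNIV" "t < sum n UNIV" for r t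
  proof -
    obtain a i where a: "i < n a" "r = offset n a + i" using block_index_cases[OF rt(1)] .
    obtain b j where b: "j < n b" "t = offset n b + j" using block_index_cases[OF rt(2)] .
    show ?thesis using hom[OF a(1) b(1)] a b by (simp add: block_index)
  qed
  have f: "order_ge (Suc K) (euler f - f * S)" "order_ge 1 (f - 1)"
    using log_derivative_det[OF M M_hom, of K] one_minus_homogeneous(3)[OF M M_hom]
    by (simp_all add: f_def S_def)
  have S: "order_ge 1 S"
    unfolding S_def
  proof (rule order_ge_sum)
    fix k assume k: "k \<in> {1..K}"
    have "order_ge 1 ((M ^\<^sub>m k) $$ (i, i))" if "i < sum n UNIV" for i
      using order_ge_mono[OF homogeneous_order_ge[OF homogeneous_pow_mat[OF M M_hom that that]]] k
      by simp
    then show "order_ge 1 (mat_trace (M ^\<^sub>m k))"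
      using M by (auto simp: mat_trace_def intro: order_ge_sum)
  qed
  have h: "order_ge 0 (h c)" "order_ge 1 (h c - 1)" "order_ge (Suc K) (euler (h c) - h c * s c)"
    if c: "c \<in> prime_cyclic_walks" for c
  proof -
    have w: "start c \<noteq> []"
      using prime_cyclic_walk_member(1)[OF c start[OF c]] closed_walk_nonempty by blast
    note carrier = walk_mat_carrier[OF w, of n M]
    note homogeneous = homogeneous_walk_mat[of n M, OF hom w]
    show "order_ge 0 (h c)"
      unfolding h_def by (rule one_minus_homogeneous(2)[OF carrier homogeneous])
    have "order_ge (length (start c)) (h c - 1)"
      unfolding h_def by (rule one_minus_homogeneous(3)[OF carrier homogeneous])
    then show "order_ge 1 (h c - 1)"
      by (rule order_ge_mono) (use w in \<open>simp add: Suc_le_eq\<close>)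
    have "K < length (start c) + K div length (start c) * length (start c)"
      by (rule dividend_less_div_times) (use w in simp)
    then have "Suc K \<le> Suc (K div length (start c)) * length (start c)" by simp
    with log_derivative_det[OF carrier homogeneous]
    show "order_ge (Suc K) (euler (h c) - h c * s c)"
      unfolding h_def s_def by (rule order_ge_mono)
  qed
  have finite_C: "finite ?C" using finite_prime_cyclic_walks_length_le[OF start] by simp
  have "coeff_laurent (prod h F) m = coeff_laurent f m"
    if F: "finite F" "F \<subseteq> prime_cyclic_walks" "?C \<subseteq> F" for F
  proof -
    \<comment> \<open>A walk longer than \<open>K\<close> has \<open>K div length = 0\<close>, so that its \<open>s\<close> is an empty sum.\<close>
    have "sum s F = sum s ?C"
    proof (rule sum.mono_neutral_right[OF F(1,3)])
      show "\<forall>c\<in>F - ?C. s c = 0"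
      proof
        fix c assume "c \<in> F - ?C"
        then have "K div length (start c) = 0" using F(2) by auto
        then show "s c = 0" by (simp add: s_def)
      qed
    qed
    then have "sum s F = S"
      using sum_trace_pow_mat[OF M diag start, of K] by (simp add: S_def s_def)
    moreover have "order_ge (Suc K) (euler (prod h F) - prod h F * sum s F)"
      using F h by (intro log_derivative_prod) auto
    ultimately have g: "order_ge (Suc K) (euler (prod h F) - prod h F * S)" by simp
    have "order_ge 1 (prod h F - (\<Prod>c\<in>F. 1))"
      using F h by (intro order_ge_prod_diff) (auto simp: order_ge_1)
    then have "order_ge 1 (prod h F - 1)" by simp
    then have "order_ge 1 ((prod h F - 1) - (f - 1))"
      by (rule order_ge_diff[OF _ f(2)])
    then have "order_ge 1 (prod h F - f)" by simp
    then have "order_ge (Suc K) (prod h F - f)"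
      by (rule log_derivative_unique[OF g f(1) S])
    moreover have "\<not> total_degree m \<le> - int (Suc K)" by (simp add: K_def)
    ultimately have "coeff_laurent (prod h F - f) m = 0"
      unfolding order_ge_def by blast
    then show ?thesis by (simp add: coeff_laurent_simps)
  qed
  then show "\<forall>\<^sub>F F in finite_subsets_at_top prime_cyclic_walks.
      coeff_laurent (\<Prod>c\<in>F. det (1\<^sub>m (n (hd (start c))) - walk_mat n M (start c))) m =
      coeff_laurent (det (1\<^sub>m (sum n UNIV) - M)) m"
    unfolding eventually_finite_subsets_at_top f_def h_def using finite_C by blast
qed

lemma has_formal_prod_cong:
  assumes "has_formal_prod f I L" "\<And>i. i \<in> I \<Longrightarrow> f i = g i"
  shows "has_formal_prod g I L"
  unfolding has_formal_prod_def
proof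
  fix m
  have "\<forall>\<^sub>F F in finite_subsets_at_top I. F \<subseteq> I"
    by (rule eventually_finite_subsets_at_top_weakI)
  moreover have "\<forall>\<^sub>F F in finite_subsets_at_top I.
      coeff_laurent (\<Prod>i\<in>F. f i) m = coeff_laurent L m"
    using assms(1) by (simp add: has_formal_prod_def)
  ultimately show "\<forall>\<^sub>F F in finite_subsets_at_top I.
      coeff_laurent (\<Prod>i\<in>F. g i) m = coeff_laurent L m"
  proof eventually_elim
    case (elim F)
    then have "prod g F = prod f F" using assms(2) by (intro prod.cong) auto
    then show ?case using elim by simp
  qed
qed

lemma homogeneous_monom_laurent:
  "total_degree v = - int d \<Longrightarrow> homogeneous d (monom_laurent v c)"
  by (simp add: homogeneous_def monom_laurent.rep_eq)

lemma prod_list_inverse_variables: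
  "prod_list (map (\<lambda>a. zpow (\<lambda>b. if b = a then - 1 else 0)) w) =
    (zpow (\<lambda>a. - int (count_list w a)) :: ('p::finite, 'k::comm_ring_1) laurent)"
proof (induction w)
  case Nil
  show ?case by (simp flip: monom_laurent_0_1 add: zero_fun_def)
next
  case (Cons x w)
  have "(\<lambda>b. if b = x then - 1 else 0) + (\<lambda>a. - int (count_list w a)) =
      (\<lambda>a. - int (count_list (x # w) a))"
    by (auto simp: fun_eq_iff)
  then show ?case by (simp add: Cons monom_laurent_mult del: count_list.simps)
qed

theorem proposition1p4:
  fixes n :: "'p::{finite,linorder} \<Rightarrow> nat"
    and A :: "('p, 'k::field_char_0) laurent mat"
    and start :: "'p list set \<Rightarrow> 'p list"
  assumes n_pos: "\<And>a. 1 \<le> n a"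
    and A_carrier: "A \<in> carrier_mat (\<Sum>a\<in>UNIV. n a) (\<Sum>a\<in>UNIV. n a)"
    and diagonal: "\<And>a. block n A a a = zvar a \<cdot>\<^sub>m 1\<^sub>m (n a)"
    and off_diagonal: "\<And>a b. a \<noteq> b \<Longrightarrow> elements_mat (block n A a b) \<subseteq> range const_laurent"
    and start: "\<And>c. c \<in> prime_cyclic_walks \<Longrightarrow> start c \<in> c"
  shows "let factor = (\<lambda>c. det (1\<^sub>m (n (hd (start c))) -
             zpow (\<lambda>a. - int (visits c a)) \<cdot>\<^sub>m walk_mat n (- A) (start c)))
         in formally_multipliable factor prime_cyclic_walks \<and>
            det A = zpow (\<lambda>a. int (n a)) * formal_prod factor prime_cyclic_walks"
proof -
  define N where "N = sum n UNIV"
  define z :: "'p \<Rightarrow> ('p, 'k) laurent" where "z a = zvar a" for a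
  define y :: "'p \<Rightarrow> ('p, 'k) laurent" where "y a = zpow (\<lambda>b. if b = a then - 1 else 0)" for a
  \<comment> \<open>\<open>D\<close> is the block diagonal part of \<open>A\<close>, and \<open>M = 1 - D\<inverse> A\<close>.\<close>
  define D where "D = mat N N (\<lambda>(r, t). if r = t then z (block_of n r) else 0)"
  define M where "M = mat N N (\<lambda>(r, t). (if r = t then 1 else 0) - y (block_of n r) * A $$ (r, t))"
  have A: "A \<in> carrier_mat N N" using A_carrier by (simp add: N_def)
  have M: "M \<in> carrier_mat N N" by (simp add: M_def)
  have zy: "z a * y a = 1" for a
  proof -
    have "(\<lambda>b. if b = a then 1 else 0) + (\<lambda>b. if b = a then - 1 else 0) = (0 :: 'p \<Rightarrow> int)"
      by (auto simp: fun_eq_iff)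
    then show ?thesis by (simp add: z_def y_def monom_laurent_mult monom_laurent_0_1)
  qed
  have less: "offset n a + i < N" if "i < n a" for a i
    using offset_le_total[of n a] that by (simp add: N_def)
  have M_index: "block n M a b $$ (i, j) =
      (if a = b \<and> i = j then 1 else 0) - y a * block n A a b $$ (i, j)"
    if "i < n a" "j < n b" for a b i j
    using that less offset_eq_iff[of i n a j b]
    by (simp add: block_index M_def block_of_offset)
  have M_diag: "block n M a a = 0\<^sub>m (n a) (n a)" for a
  proof (rule eq_matI)
    fix i j assume "i < dim_row (0\<^sub>m (n a) (n a) :: ('p, 'k) laurent mat)"
      "j < dim_col (0\<^sub>m (n a) (n a) :: ('p, 'k) laurent mat)"
    then show "block n M a a $$ (i, j) = 0\<^sub>m (n a) (n a) $$ (i, j)"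
      using zy[of a] by (simp add: M_index diagonal z_def mult.commute)
  qed (simp_all add: block_def)
  have M_off: "block n M a b = y a \<cdot>\<^sub>m block n (- A) a b" if "a \<noteq> b" for a b
  proof (rule eq_matI)
    fix i j assume "i < dim_row (y a \<cdot>\<^sub>m block n (- A) a b)" "j < dim_col (y a \<cdot>\<^sub>m block n (- A) a b)"
    then have ij: "i < n a" "j < n b" by (simp_all add: block_def)
    then show "block n M a b $$ (i, j) = (y a \<cdot>\<^sub>m block n (- A) a b) $$ (i, j)"
      using A less that block_carrier[of n "- A" a b] by (simp add: M_index) (simp add: block_index)
  qed (simp_all add: block_def)
  have M_hom: "homogeneous 1 (block n M a b $$ (i, j))" if ij: "i < n a" "j < n b" for a b i j
  proof (cases "a = b")
    case True
    then show ?thesis using ij by (simp add: M_diag homogeneous_0)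
  next
    case False
    then obtain x where x: "block n A a b $$ (i, j) = const_laurent x"
      using off_diagonal elements_matI[OF block_carrier[of n A a b] ij refl] by blast
    have "- (y a * const_laurent x) = monom_laurent (\<lambda>b. if b = a then - 1 else 0) (- x)"
      by (simp add: y_def monom_laurent_mult)
         (rule laurent_eqI, simp add: coeff_laurent_simps monom_laurent.rep_eq)
    then have "block n M a b $$ (i, j) = monom_laurent (\<lambda>b. if b = a then - 1 else 0) (- x)"
      using False ij by (simp add: M_index x)
    then show ?thesis
      by (simp add: homogeneous_monom_laurent total_degree_def)
  qed
  have walk: "walk_mat n M (start c) =
      zpow (\<lambda>a. - int (visits c a)) \<cdot>\<^sub>m walk_mat n (- A) (start c)"
    if c: "c \<in> prime_cyclic_walks" for c
  proof -
    note w = prime_cyclic_walk_member[OF c start[OF c]]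
    have "visits c a = count_list (start c) a" for a
      using visits_cyclic_class[OF closed_walk_nonempty[OF w(1)]] w(3) by metis
    then show ?thesis
      using walk_mat_scale[OF M_off w(1)] by (simp add: y_def prod_list_inverse_variables)
  qed
  define factor where "factor = (\<lambda>c. det (1\<^sub>m (n (hd (start c))) -
    zpow (\<lambda>a. - int (visits c a)) \<cdot>\<^sub>m walk_mat n (- A) (start c)))"
  have "has_formal_prod (\<lambda>c. det (1\<^sub>m (n (hd (start c))) - walk_mat n M (start c)))
      prime_cyclic_walks (det (1\<^sub>m N - M))"
    unfolding N_def
    by (rule det_eq_formal_prod_prime_walks[OF M[unfolded N_def] M_hom M_diag start])
  then have prod: "has_formal_prod factor prime_cyclic_walks (det (1\<^sub>m N - M))"
    by (rule has_formal_prod_cong) (simp add: factor_def walk)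
  have A_eq: "A = D * (1\<^sub>m N - M)"
  proof (rule eq_matI)
    fix r t assume "r < dim_row (D * (1\<^sub>m N - M))" "t < dim_col (D * (1\<^sub>m N - M))"
    then have rt: "r < N" "t < N" using M by (auto simp: D_def)
    have "(D * (1\<^sub>m N - M)) $$ (r, t) = (\<Sum>u<N. D $$ (r, u) * (1\<^sub>m N - M) $$ (u, t))"
      using rt M by (simp add: D_def scalar_prod_def lessThan_atLeast0)
    also have "\<dots> = (\<Sum>u<N. if u = r then z (block_of n r) * (1\<^sub>m N - M) $$ (r, t) else 0)"
      using rt by (intro sum.cong) (auto simp: D_def)
    also have "\<dots> = z (block_of n r) * (1\<^sub>m N - M) $$ (r, t)"
      using rt by simp
    also have "(1\<^sub>m N - M) $$ (r, t) = y (block_of n r) * A $$ (r, t)"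
      using rt M by simp (simp add: M_def)
    finally show "A $$ (r, t) = (D * (1\<^sub>m N - M)) $$ (r, t)"
      by (simp add: zy flip: mult.assoc)
  qed (use A M in \<open>auto simp: D_def\<close>)
  have D: "D \<in> carrier_mat N N" by (simp add: D_def)
  have "det D = (\<Prod>r<N. z (block_of n r))"
    using det_upper_triangular[OF _ D]
    by (simp add: D_def upper_triangular_def prod_list_diag_prod lessThan_atLeast0)
  also have "\<dots> = zpow (\<lambda>a. int (n a))"
    unfolding N_def prod_blocks zpow_eq_prod by (simp add: block_of_offset z_def)
  finally have "det D = zpow (\<lambda>a. int (n a))" .
  then have "det A = zpow (\<lambda>a. int (n a)) * det (1\<^sub>m N - M)"
    using det_mult[OF D minus_carrier_mat[OF M]] A_eq by simp
  moreover have "formally_multipliable factor prime_cyclic_walks"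
    unfolding formally_multipliable_def using prod by blast
  ultimately show ?thesis
    using formal_prod_eqI[OF prod] unfolding factor_def[symmetric] Let_def by simp
qed

end
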